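(* If $F$ is a flat geodesic in $G$ and $\mu\in G$, then there exists a unique point $\lambda_0\in F$ such that $$d_G(\lambda_0,\mu)=\inf_{\lambda\in F}d_G(\lambda,\mu).$$
   Context: $\mathbb{D}$ is the open unit disc in $\mathbb{C}$. $G=\{(z+w,zw): |z|<1,|w|<1\}\subset\mathbb{C}^2$ is the symmetrized bidisc. For $\lambda,\mu\in G$, $d_G(\lambda,\mu)$ is the Carathéodory distance, $d_G(\lambda,\mu)=\sup_{f}\tanh^{-1}\left|\frac{f(\lambda)-f(\mu)}{1-\overline{f(\mu)}f(\lambda)}\right|$, the supremum being over all holomorphic $f:G\to\mathbb{D}$ (it is known to coincide with the Kobayashi distance on $G$). A geodesic (that is, complex geodesic) in $G$ is a set $D=h(\mathbb{D})$ where $h:\mathbb{D}\to G$ is holomorphic and has a holomorphic left inverse $\Phi:G\to\mathbb{D}$, $\Phi\circ h=\mathrm{id}_{\mathbb{D}}$. The royal variety is $\mathcal{R}=\{(2z,z^2):z\in\mathbb{D}\}$. A geodesic $D$ is flat if $D^-\cap\mathcal{R}^-$ (closures in $\mathbb{C}^2$) consists of a single point, and that point lies in $\mathcal{R}$; equivalently (known), $D=F^\beta=\{(\beta+\bar\beta z,z):z\in\mathbb{D}\}$ for some $\beta\in\mathbb{D}$. *)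

theory Defs
  imports "HOL-Complex_Analysis.Complex_Analysis" "HOL-Library.Extended_Real"
begin

abbreviation unit_disc :: "complex set" where
  "unit_disc \<equiv> ball 0 1"

(* The map (u,v) \<mapsto> a u + b v is the general complex-linear functional on C^2. *)
definition holomorphic_on_C2 :: "(complex \<times> complex \<Rightarrow> complex) \<Rightarrow> (complex \<times> complex) set \<Rightarrow> bool" where
  "holomorphic_on_C2 f S \<longleftrightarrow>
     (\<forall>p\<in>S. \<exists>a b. (f has_derivative (\<lambda>(u, v). a * u + b * v)) (at p within S))"

definition symm_bidisc :: "(complex \<times> complex) set" where
  "symm_bidisc = {(z + w, z * w) | z w. z \<in> unit_disc \<and> w \<in> unit_disc}"

definition royal_variety :: "(complex \<times> complex) set" where
  "royal_variety = {(2 * z, z ^ 2) | z. z \<in> unit_disc}"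

(* Extended-real valued, so that the supremum is meaningful without first knowing that it is finite. *)
definition caratheodory_dist ::
  "(complex \<times> complex) set \<Rightarrow> complex \<times> complex \<Rightarrow> complex \<times> complex \<Rightarrow> ereal" where
  "caratheodory_dist S p q =
     (SUP f \<in> {f. holomorphic_on_C2 f S \<and> f ` S \<subseteq> unit_disc}.
        ereal (artanh (cmod ((f p - f q) / (1 - cnj (f q) * f p)))))"

definition complex_geodesic :: "(complex \<times> complex) set \<Rightarrow> bool" where
  "complex_geodesic D \<longleftrightarrow>
     (\<exists>h \<Phi>. (\<lambda>z. fst (h z)) holomorphic_on unit_disc \<and> (\<lambda>z. snd (h z)) holomorphic_on unit_disc \<and>
            h ` unit_disc \<subseteq> symm_bidisc \<and>
            holomorphic_on_C2 \<Phi> symm_bidisc \<and> \<Phi> ` symm_bidisc \<subseteq> unit_disc \<and>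
            (\<forall>z\<in>unit_disc. \<Phi> (h z) = z) \<and>
            D = h ` unit_disc)"

definition flat_geodesic :: "(complex \<times> complex) set \<Rightarrow> bool" where
  "flat_geodesic D \<longleftrightarrow>
     complex_geodesic D \<and> (\<exists>p\<in>royal_variety. closure D \<inter> closure royal_variety = {p})"

end

theory Submission
  imports Defs
begin

text \<open>
  The Caratheodory distance of the symmetrized bidisc $G$ is governed by one circle of functions, the
  magic functions $\Phi_\omega(s,p) = (2\omega p - s)/(2 - \omega s)$ with $|\omega| = 1$: for any two points
  of $G$ the supremum defining the distance is attained at some $\Phi_\omega$
  (\<open>caratheodory_dist_symm_bidisc\<close>). On a flat geodesic $F = h(D)$, with $D$ the unit disc, every single
  $\Phi_\omega$ restricts to an automorphism of the disc (\<open>flat_geodesic_magic_isometries\<close>). So each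
  $\omega$ has a point $w_\omega$ of the disc with $\Phi_\omega(h(w_\omega)) = \Phi_\omega(\mu)$, and the distance
  from $h(z)$ to $\mu$ is the largest hyperbolic distance from $z$ to the points $w_\omega$. A nearest point
  of $F$ is therefore a Chebyshev centre of the set of all $w_\omega$ in the hyperbolic plane. Such a
  centre exists because hyperbolic discs are compact, and it is unique because the midpoint of two
  centres would be strictly closer to all of the set (\<open>Chebyshev_centre_unique\<close>).

  Both facts about $\Phi_\omega$ come from one change of coordinates. For a point $(z+w, zw)$ of $G$, move
  $z$ and $w$ to the upper half-plane by the Cayley transform, obtaining $Z$ and $W$, and put
  $m = (Z+W)/2$, $Q = ((Z-W)/2)^2$. Up to a fixed Moebius map, $\Phi_1$ becomes $m$ and the other magic
  functions become $m - Q/(m-x)$ with $x$ real. Suppose $\Phi_1$ separates two given points best.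
  Comparing it with large $x$ gives a linear relation, and this relation says exactly that the two
  values of $Q$ are interpolated by a quadratic polynomial $q$ with real coefficients in $m$. Comparing
  it with finite $x$ shows that $q \ge 0$ on the real line and that the leading coefficient $c$ of $q$ is
  at most $1$, with $q > 0$ if $c = 1$. These conditions put the disc $\tau \mapsto (\tau, q(\tau))$ inside $G$. It passes through
  both points, and the Schwarz-Pick lemma on it bounds every competitor by $\Phi_1$.

  Along a complex geodesic some magic function, after a rotation $\Phi_1$, is an isometry, so it is
  the best one for all pairs of points at once. Then the whole geodesic is the graph of one real
  quadratic polynomial. If $c \ne 1$, both $Z$ and $W$ tend to infinity as $\tau$ does, so the geodesic
  reaches a boundary point of the royal variety. Flatness excludes this. Hence $c = 1$, and then
  $m - Q/(m-x)$ equals $-q(x)/(\tau - x)$ up to a real constant: a Moebius map for every $x$.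
\<close>

section \<open>The pseudohyperbolic distance and the Schwarz-Pick lemma\<close>

definition pseudo_dist :: "complex \<Rightarrow> complex \<Rightarrow> real" where
  "pseudo_dist z w = cmod ((z - w) / (1 - cnj w * z))"

definition disc_moebius :: "complex \<Rightarrow> complex \<Rightarrow> complex" where
  "disc_moebius a z = (z - a) / (1 - cnj a * z)"

lemma one_minus_cnj_mult_nonzero:
  assumes "cmod w < 1" "cmod z < 1"
  shows "1 - cnj w * z \<noteq> 0"
proof
  assume "1 - cnj w * z = 0"
  then have "cmod (cnj w * z) = 1"
    by (metis eq_iff_diff_eq_0 norm_one)
  moreover have "cmod w * cmod z < 1"
    using assms by (metis mult_strict_mono' norm_ge_zero mult_1)
  ultimately show False
    by (simp add: norm_mult)
qed

lemma cmod_one_minus_cnj_mult_sq: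
  "(cmod (1 - cnj w * z))\<^sup>2 - (cmod (z - w))\<^sup>2 = (1 - (cmod z)\<^sup>2) * (1 - (cmod w)\<^sup>2)"
  unfolding cmod_power2 by (simp add: algebra_simps power2_eq_square)

lemma one_minus_pseudo_dist_sq:
  assumes "cmod w < 1" "cmod z < 1"
  shows "1 - (pseudo_dist z w)\<^sup>2 = (1 - (cmod z)\<^sup>2) * (1 - (cmod w)\<^sup>2) / (cmod (1 - cnj w * z))\<^sup>2"
  using one_minus_cnj_mult_nonzero[OF assms]
  by (simp add: pseudo_dist_def norm_divide power_divide divide_simps
      flip: cmod_one_minus_cnj_mult_sq)

lemma pseudo_dist_eq_moebius: "pseudo_dist z w = cmod (disc_moebius w z)"
  by (simp add: pseudo_dist_def disc_moebius_def)

lemma pseudo_dist_less_1: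
  assumes "cmod w < 1" "cmod z < 1"
  shows "pseudo_dist z w < 1"
proof -
  have "0 < (1 - (cmod z)\<^sup>2) * (1 - (cmod w)\<^sup>2) / (cmod (1 - cnj w * z))\<^sup>2"
    using assms one_minus_cnj_mult_nonzero[OF assms] by (auto simp: abs_square_less_1)
  then have "(pseudo_dist z w)\<^sup>2 < 1"
    using one_minus_pseudo_dist_sq[OF assms] by linarith
  then show ?thesis
    by (simp add: abs_square_less_1 pseudo_dist_def)
qed

lemma pseudo_dist_nonneg: "0 \<le> pseudo_dist z w"
  by (simp add: pseudo_dist_def)

lemma disc_moebius_in_disc: "cmod a < 1 \<Longrightarrow> cmod z < 1 \<Longrightarrow> cmod (disc_moebius a z) < 1"
  using pseudo_dist_less_1 by (simp add: pseudo_dist_eq_moebius)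

lemma disc_moebius_inverse:
  assumes "cmod a < 1" "cmod z < 1"
  shows "disc_moebius a (disc_moebius (- a) z) = z" "disc_moebius (- a) (disc_moebius a z) = z"
proof -
  have *: "disc_moebius a (disc_moebius (- a) z) = z" if a: "cmod a < 1" for a
  proof -
    have 1: "1 + cnj a * z \<noteq> 0" and 2: "1 - cnj a * a \<noteq> 0"
      using one_minus_cnj_mult_nonzero[of "-a" z] one_minus_cnj_mult_nonzero[of a a] a assms by auto
    have "(z + a) / (1 + cnj a * z) - a = z * (1 - cnj a * a) / (1 + cnj a * z)"
      "1 - cnj a * ((z + a) / (1 + cnj a * z)) = (1 - cnj a * a) / (1 + cnj a * z)"
      using 1 by (simp_all add: field_simps)
    then show ?thesis
      using 1 2 by (simp add: disc_moebius_def)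
  qed
  show "disc_moebius a (disc_moebius (- a) z) = z" "disc_moebius (- a) (disc_moebius a z) = z"
    using *[of a] *[of "-a"] assms by auto
qed

lemma pseudo_dist_moebius:
  assumes "cmod a < 1" "cmod z < 1" "cmod w < 1"
  shows "pseudo_dist (disc_moebius a z) (disc_moebius a w) = pseudo_dist z w"
proof -
  define A where "A = 1 - cnj a * z"
  define B where "B = 1 - cnj a * w"
  have nz: "A \<noteq> 0" "B \<noteq> 0" "cnj B \<noteq> 0"
    using one_minus_cnj_mult_nonzero assms by (auto simp: A_def B_def simp del: complex_cnj_diff)
  have n: "1 - cnj a * a \<noteq> 0"
    using one_minus_cnj_mult_nonzero assms by auto
  have z: "disc_moebius a z = (z - a) / A" and w: "disc_moebius a w = (w - a) / B"
    and cw: "cnj (disc_moebius a w) = (cnj w - cnj a) / cnj B"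
    by (simp_all add: disc_moebius_def A_def B_def)
  have "disc_moebius a z - disc_moebius a w = ((z - a) * B - (w - a) * A) / (A * B)"
    unfolding z w using nz by (simp add: diff_frac_eq)
  also have "(z - a) * B - (w - a) * A = (z - w) * (1 - cnj a * a)"
    by (simp add: A_def B_def algebra_simps)
  finally have 1: "disc_moebius a z - disc_moebius a w = (z - w) * (1 - cnj a * a) / (A * B)" .
  have "1 - cnj (disc_moebius a w) * disc_moebius a z
      = (A * cnj B - (cnj w - cnj a) * (z - a)) / (A * cnj B)"
    unfolding z cw diff_divide_distrib[of "A * cnj B"] using nz by (simp add: mult.commute)
  also have "A * cnj B - (cnj w - cnj a) * (z - a) = (1 - cnj w * z) * (1 - cnj a * a)"
    by (simp add: A_def B_def algebra_simps)
  finally have 2: "1 - cnj (disc_moebius a w) * disc_moebius a z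
      = (1 - cnj w * z) * (1 - cnj a * a) / (A * cnj B)" .
  show ?thesis
    unfolding pseudo_dist_def 1 2 using nz n by (simp add: norm_divide norm_mult divide_simps)
qed

lemma pseudo_dist_rotate: "cmod u = 1 \<Longrightarrow> pseudo_dist (u * z) (u * w) = pseudo_dist z w"
proof -
  assume u: "cmod u = 1"
  then have "cnj u * u = 1"
    by (metis complex_norm_square mult.commute of_real_1 one_power2)
  moreover have "cnj (u * w) * (u * z) = (cnj u * u) * (cnj w * z)"
    by simp
  ultimately have "cnj (u * w) * (u * z) = cnj w * z"
    by (metis mult_1)
  moreover have "u * z - u * w = u * (z - w)"
    by (simp add: algebra_simps)
  ultimately show ?thesis
    unfolding pseudo_dist_def using u by (metis norm_divide norm_mult mult_1)
qed

lemma pseudo_dist_0_iff: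
  assumes "cmod w < 1" "cmod z < 1"
  shows "pseudo_dist z w = 0 \<longleftrightarrow> z = w"
  using one_minus_cnj_mult_nonzero[OF assms] by (auto simp: pseudo_dist_def)

lemma holomorphic_disc_moebius:
  assumes "cmod a < 1" shows "disc_moebius a holomorphic_on unit_disc"
  unfolding disc_moebius_def using one_minus_cnj_mult_nonzero[OF assms]
  by (intro holomorphic_intros) auto

text \<open>
  The Schwarz lemma for $f$ conjugated by Moebius maps that send $b$ and $f(b)$ to $0$. Equality for one
  pair of points makes the conjugated map a rotation, which gives the two rigidity statements.
\<close>

lemma Schwarz_Pick:
  assumes f: "f holomorphic_on unit_disc" "f ` unit_disc \<subseteq> unit_disc"
    and a: "a \<in> unit_disc" and b: "b \<in> unit_disc"
  shows Schwarz_Pick_le: "pseudo_dist (f a) (f b) \<le> pseudo_dist a b"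
    and Schwarz_Pick_isometry: "a \<noteq> b \<Longrightarrow> pseudo_dist (f a) (f b) = pseudo_dist a b \<Longrightarrow>
          z \<in> unit_disc \<Longrightarrow> w \<in> unit_disc \<Longrightarrow> pseudo_dist (f z) (f w) = pseudo_dist z w"
    and Schwarz_Pick_surj: "a \<noteq> b \<Longrightarrow> pseudo_dist (f a) (f b) = pseudo_dist a b \<Longrightarrow>
          unit_disc \<subseteq> f ` unit_disc"
proof -
  have fd: "cmod (f z) < 1" if "cmod z < 1" for z
    using f(2) that by (simp add: image_subset_iff)
  have a1: "cmod a < 1" and b1: "cmod b < 1"
    using a b by auto
  define F where "F = disc_moebius (f b) \<circ> f \<circ> disc_moebius (- b)"
  have hF: "F holomorphic_on unit_disc"
    unfolding F_def
  proof (intro holomorphic_on_compose_gen[where t = unit_disc])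
    show "disc_moebius (- b) ` unit_disc \<subseteq> unit_disc"
      using b1 by (auto intro!: disc_moebius_in_disc)
  qed (use fd b1 f in \<open>auto intro!: holomorphic_disc_moebius\<close>)
  have F0: "F 0 = 0"
    by (simp add: F_def disc_moebius_def)
  have F1: "cmod (F z) < 1" if "cmod z < 1" for z
    unfolding F_def o_apply using that b1 by (intro disc_moebius_in_disc fd) auto
  have Feq: "disc_moebius (f b) (f z) = F (disc_moebius b z)" if "cmod z < 1" for z
    using that b1 by (simp add: F_def disc_moebius_inverse)
  have ma: "cmod (disc_moebius b a) < 1"
    using a1 b1 by (rule disc_moebius_in_disc[rotated])
  show "pseudo_dist (f a) (f b) \<le> pseudo_dist a b"
    using Schwarz_Lemma(1)[OF hF F0 F1 ma] Feq[OF a1] by (simp add: pseudo_dist_eq_moebius)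
  assume ab: "a \<noteq> b" and eq: "pseudo_dist (f a) (f b) = pseudo_dist a b"
  have "disc_moebius b a \<noteq> 0"
    using ab pseudo_dist_0_iff[OF b1 a1] by (auto simp: pseudo_dist_eq_moebius)
  moreover have "cmod (F (disc_moebius b a)) = cmod (disc_moebius b a)"
    using eq Feq[OF a1] by (simp add: pseudo_dist_eq_moebius)
  ultimately obtain u where u: "\<And>z. cmod z < 1 \<Longrightarrow> F z = u * z" "cmod u = 1"
    using Schwarz_Lemma(3)[OF hF F0 F1 ma] ma by blast
  have fu: "disc_moebius (f b) (f z) = u * disc_moebius b z" if "cmod z < 1" for z
    using Feq[OF that] u(1) disc_moebius_in_disc[OF b1 that] by simp
  show "pseudo_dist (f z) (f w) = pseudo_dist z w" if "z \<in> unit_disc" "w \<in> unit_disc"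
  proof -
    have "cmod z < 1" "cmod w < 1"
      using that by auto
    then have "pseudo_dist (f z) (f w) = pseudo_dist (u * disc_moebius b z) (u * disc_moebius b w)"
      using pseudo_dist_moebius[of "f b" "f z" "f w"] fd b1 fu by simp
    also have "\<dots> = pseudo_dist z w"
      using pseudo_dist_rotate[OF u(2)] pseudo_dist_moebius[of b z w] b1 \<open>cmod z < 1\<close> \<open>cmod w < 1\<close> by simp
    finally show ?thesis .
  qed
  show "unit_disc \<subseteq> f ` unit_disc"
  proof
    fix y assume "y \<in> unit_disc"
    then have y: "cmod y < 1" by simp
    define t where "t = inverse u * disc_moebius (f b) y"
    have t: "cmod t < 1"
      using y fd[OF b1] u(2) by (simp add: t_def norm_mult norm_inverse disc_moebius_in_disc)
    define z where "z = disc_moebius (- b) t"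
    have z: "cmod z < 1"
      using t b1 by (simp add: z_def disc_moebius_in_disc)
    have "disc_moebius (f b) (f z) = u * t"
      using fu[OF z] t b1 by (simp add: z_def disc_moebius_inverse)
    also have "\<dots> = disc_moebius (f b) y"
    proof -
      have "u \<noteq> 0" using u(2) by auto
      then show ?thesis by (simp add: t_def)
    qed
    finally have "f z = y"
      using disc_moebius_inverse(2)[OF fd[OF b1]] fd[OF z] y by metis
    then show "y \<in> f ` unit_disc"
      using z by auto
  qed
qed

lemma artanh_le_iff:
  fixes x y :: real
  assumes "0 \<le> x" "x < 1" "0 \<le> y" "y < 1"
  shows "artanh x \<le> artanh y \<longleftrightarrow> x \<le> y"
proof -
  have lt: "artanh u < artanh v" if "0 \<le> u" "u < v" "v < 1" for u v :: real
    using that by (simp add: artanh_def frac_less)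
  show ?thesis
    using lt[of x y] lt[of y x] assms by (cases x y rule: linorder_cases) auto
qed

section \<open>Chebyshev centres in the hyperbolic disc\<close>

text \<open>
  If $\rho$ is the artanh of the pseudohyperbolic distance, this is $\cosh 2\rho$. It increases with the
  distance and, unlike the distance itself, is bilinear in the hyperboloid model.
\<close>

definition cosh_dist :: "complex \<Rightarrow> complex \<Rightarrow> real" where
  "cosh_dist z w = ((1 + (cmod z)\<^sup>2) * (1 + (cmod w)\<^sup>2) - 4 * Re (cnj w * z))
      / ((1 - (cmod z)\<^sup>2) * (1 - (cmod w)\<^sup>2))"

lemma cosh_dist_pseudo_dist:
  assumes "cmod z < 1" "cmod w < 1"
  shows "(1 + cosh_dist z w) * (1 - (pseudo_dist z w)\<^sup>2) = 2"
proof -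
  define P where "P = (1 - (cmod z)\<^sup>2) * (1 - (cmod w)\<^sup>2)"
  define N where "N = (cmod (1 - cnj w * z))\<^sup>2"
  have "P > 0"
    using assms by (simp add: P_def abs_square_less_1)
  have "N > 0"
    using one_minus_cnj_mult_nonzero[OF assms(2,1)] by (simp add: N_def)
  have "(1 + (cmod z)\<^sup>2) * (1 + (cmod w)\<^sup>2) - 4 * Re (cnj w * z) + P = 2 * N"
    unfolding P_def N_def cmod_power2 by (simp add: algebra_simps power2_eq_square)
  then have "1 + cosh_dist z w = 2 * N / P"
    unfolding cosh_dist_def P_def[symmetric] using \<open>P > 0\<close> by (simp add: field_simps)
  moreover have "1 - (pseudo_dist z w)\<^sup>2 = P / N"
    using one_minus_pseudo_dist_sq[OF assms(2,1)] by (simp add: P_def N_def)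
  ultimately show ?thesis
    using \<open>P > 0\<close> \<open>N > 0\<close> by simp
qed

lemma cosh_dist_eq:
  assumes "cmod z < 1" "cmod w < 1"
  shows "cosh_dist z w = 2 / (1 - (pseudo_dist z w)\<^sup>2) - 1"
proof -
  have "1 - (pseudo_dist z w)\<^sup>2 \<noteq> 0"
    using cosh_dist_pseudo_dist[OF assms] by auto
  then show ?thesis
    using cosh_dist_pseudo_dist[OF assms] by (simp add: field_simps)
qed

lemma cosh_dist_le_iff:
  assumes "cmod z < 1" "cmod w < 1" "cmod z' < 1" "cmod w' < 1"
  shows "cosh_dist z w \<le> cosh_dist z' w' \<longleftrightarrow> pseudo_dist z w \<le> pseudo_dist z' w'"
proof -
  have "0 < 1 - (pseudo_dist z w)\<^sup>2" "0 < 1 - (pseudo_dist z' w')\<^sup>2"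
    using pseudo_dist_less_1 assms by (auto simp: abs_square_less_1 pseudo_dist_nonneg)
  then have "cosh_dist z w \<le> cosh_dist z' w' \<longleftrightarrow> (pseudo_dist z w)\<^sup>2 \<le> (pseudo_dist z' w')\<^sup>2"
    using assms by (simp add: cosh_dist_eq) (simp add: field_simps)
  then show ?thesis
    by (simp add: pseudo_dist_nonneg abs_le_square_iff[symmetric])
qed

lemma cosh_dist_ge_1:
  assumes "cmod z < 1" "cmod w < 1"
  shows "1 \<le> cosh_dist z w"
proof -
  have "0 < 1 - (pseudo_dist z w)\<^sup>2" "(pseudo_dist z w)\<^sup>2 \<ge> 0"
    using pseudo_dist_less_1 assms by (auto simp: abs_square_less_1 pseudo_dist_nonneg)
  then show ?thesis
    using assms by (simp add: cosh_dist_eq) (simp add: field_simps)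
qed

text \<open>
  A timelike vector $(t,v)$ of Lorentz space is a positive multiple of the point of the hyperboloid that
  represents some $M$ in the disc.
\<close>

lemma hyperboloid_point:
  assumes "cmod v < t"
  obtains M \<kappa> where "cmod M < 1" "0 < \<kappa>" "\<kappa>\<^sup>2 = t\<^sup>2 - (cmod v)\<^sup>2"
    "\<kappa> * ((1 + (cmod M)\<^sup>2) / (1 - (cmod M)\<^sup>2)) = t"
    "of_real \<kappa> * (2 * M / of_real (1 - (cmod M)\<^sup>2)) = v"
proof -
  have pos: "(cmod v)\<^sup>2 < t\<^sup>2" "0 < t"
    using assms norm_ge_zero[of v] by (blast intro: power_strict_mono zero_less_numeral, linarith)
  define \<kappa> where "\<kappa> = sqrt (t\<^sup>2 - (cmod v)\<^sup>2)"
  have k: "0 < \<kappa>" "\<kappa>\<^sup>2 = t\<^sup>2 - (cmod v)\<^sup>2"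
    using pos assms by (auto simp: \<kappa>_def)
  \<comment> \<open>Projection from the point $(-1,0)$ carries the hyperboloid to the disc.\<close>
  define M where "M = v / of_real (t + \<kappa>)"
  have tk: "t + \<kappa> > 0"
    using k pos by linarith
  have "(cmod M)\<^sup>2 = (t\<^sup>2 - \<kappa>\<^sup>2) / (t + \<kappa>)\<^sup>2"
    using tk k by (simp add: M_def norm_divide power_divide flip: of_real_add)
  also have "\<dots> = (t - \<kappa>) / (t + \<kappa>)"
    using tk by (simp add: power2_eq_square divide_simps) (simp add: algebra_simps)
  finally have M: "(cmod M)\<^sup>2 = (t - \<kappa>) / (t + \<kappa>)" .
  have M1: "1 - (cmod M)\<^sup>2 = 2 * \<kappa> / (t + \<kappa>)" and M2: "1 + (cmod M)\<^sup>2 = 2 * t / (t + \<kappa>)"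
    using tk unfolding M by (auto simp: field_simps)
  show ?thesis
  proof (rule that[of M \<kappa>])
    have "0 < 1 - (cmod M)\<^sup>2"
      using M1 tk k by simp
    then show "cmod M < 1"
      by (simp add: abs_square_less_1)
    show "\<kappa> * ((1 + (cmod M)\<^sup>2) / (1 - (cmod M)\<^sup>2)) = t"
      unfolding M1 M2 using tk k by simp
    have "complex_of_real (t + \<kappa>) \<noteq> 0"
      using tk by (metis of_real_eq_0_iff less_irrefl)
    then show "of_real \<kappa> * (2 * M / of_real (1 - (cmod M)\<^sup>2)) = v"
      unfolding M1 using k by (simp add: M_def)
  qed (use k in auto)
qed

text \<open>
  The Lorentz product of the points of the hyperboloid that represent $z$ and $w$.
\<close>

lemma cosh_dist_hyperboloid:
  "cosh_dist z w = (1 + (cmod z)\<^sup>2) / (1 - (cmod z)\<^sup>2) * ((1 + (cmod w)\<^sup>2) / (1 - (cmod w)\<^sup>2))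
     - Re (cnj (2 * w / of_real (1 - (cmod w)\<^sup>2)) * (2 * z / of_real (1 - (cmod z)\<^sup>2)))"
proof -
  have "cnj (2 * w / of_real (1 - (cmod w)\<^sup>2)) * (2 * z / of_real (1 - (cmod z)\<^sup>2))
      = 4 * (cnj w * z) / of_real ((1 - (cmod z)\<^sup>2) * (1 - (cmod w)\<^sup>2))"
    by simp
  also have "Re \<dots> = 4 * Re (cnj w * z) / ((1 - (cmod z)\<^sup>2) * (1 - (cmod w)\<^sup>2))"
    unfolding Re_divide_of_real by simp
  finally show ?thesis
    by (simp add: cosh_dist_def diff_divide_distrib)
qed

text \<open>
  The sum of two points of the hyperboloid is timelike, and so equals $2\kappa$ times the point of their
  midpoint $M$. Bilinearity gives the identity for all $w$ at once. Here $\kappa = \cosh \rho$ with $\rho$ the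
  artanh of the pseudohyperbolic distance of $z_1$ and $z_2$, hence $\kappa > 1$.
\<close>

lemma hyperbolic_midpoint:
  assumes "cmod z1 < 1" "cmod z2 < 1" "z1 \<noteq> z2"
  obtains M \<kappa> where "cmod M < 1" "1 < \<kappa>"
    "\<And>w. cmod w < 1 \<Longrightarrow> cosh_dist z1 w + cosh_dist z2 w = 2 * \<kappa> * cosh_dist M w"
proof -
  define T where "T z = (1 + (cmod z)\<^sup>2) / (1 - (cmod z)\<^sup>2)" for z
  define V where "V z = 2 * z / of_real (1 - (cmod z)\<^sup>2)" for z
  have C: "cosh_dist z w = T z * T w - Re (cnj (V w) * V z)" for z w
    using cosh_dist_hyperboloid by (simp add: T_def V_def)
  have TV: "(T z)\<^sup>2 - (cmod (V z))\<^sup>2 = 1" "0 < T z" if "cmod z < 1" for z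
  proof -
    have p: "0 < 1 - (cmod z)\<^sup>2"
      using that by (simp add: abs_square_less_1)
    then show "0 < T z"
      by (simp add: T_def add_pos_nonneg)
    show "(T z)\<^sup>2 - (cmod (V z))\<^sup>2 = 1"
      using p by (simp add: T_def V_def norm_divide norm_mult power_divide power_mult_distrib
          divide_simps del: of_real_diff) (simp add: algebra_simps power2_eq_square)
  qed
  have VT: "cmod (V z) < T z" if "cmod z < 1" for z
    using TV[OF that] by (intro power2_less_imp_less[of _ "T z"]) auto
  define t where "t = (T z1 + T z2) / 2"
  define v where "v = (V z1 + V z2) / 2"
  have "cmod v \<le> (cmod (V z1) + cmod (V z2)) / 2"
    using norm_triangle_ineq[of "V z1" "V z2"] by (simp add: v_def norm_divide)
  then have "cmod v < t"
    using VT[OF assms(1)] VT[OF assms(2)] by (simp add: t_def)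
  then obtain M \<kappa> where M: "cmod M < 1" "0 < \<kappa>" "\<kappa>\<^sup>2 = t\<^sup>2 - (cmod v)\<^sup>2" "\<kappa> * T M = t" "of_real \<kappa> * V M = v"
    unfolding T_def V_def by (rule hyperboloid_point)
  have "4 * \<kappa>\<^sup>2 = 2 + 2 * cosh_dist z1 z2"
  proof -
    have "4 * \<kappa>\<^sup>2 = (T z1 + T z2)\<^sup>2 - (cmod (V z1 + V z2))\<^sup>2"
      by (simp add: M(3) t_def v_def norm_divide power_divide algebra_simps)
    also have "\<dots> = ((T z1)\<^sup>2 - (cmod (V z1))\<^sup>2) + ((T z2)\<^sup>2 - (cmod (V z2))\<^sup>2) + 2 * cosh_dist z1 z2"
      unfolding cmod_power2 C by (simp add: algebra_simps power2_eq_square)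
    finally show ?thesis
      using TV assms by simp
  qed
  moreover have "1 < cosh_dist z1 z2"
    using cosh_dist_ge_1[OF assms(1,2)] cosh_dist_pseudo_dist[OF assms(1,2)]
      pseudo_dist_0_iff[OF assms(2,1)] assms(3) by (cases "cosh_dist z1 z2 = 1") auto
  ultimately have "1 < \<kappa>\<^sup>2"
    by linarith
  then have "1 < \<kappa>"
    using M(2) by (metis abs_of_pos abs_square_le_1 linorder_not_le)
  moreover have "cosh_dist z1 w + cosh_dist z2 w = 2 * \<kappa> * cosh_dist M w" for w
  proof -
    have "\<kappa> * cosh_dist M w = (\<kappa> * T M) * T w - Re (cnj (V w) * (of_real \<kappa> * V M))"
      unfolding C by (simp add: algebra_simps)
    also have "2 * \<dots> = cosh_dist z1 w + cosh_dist z2 w"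
    proof -
      have "2 * (t * T w - Re (cnj (V w) * v)) = (2 * t) * T w - Re (cnj (V w) * (2 * v))"
        by (simp add: algebra_simps)
      also have "2 * t = T z1 + T z2" by (simp add: t_def)
      also have "2 * v = V z1 + V z2" by (simp add: v_def)
      finally show ?thesis
        unfolding M C by (simp add: algebra_simps)
    qed
    finally show ?thesis by simp
  qed
  ultimately show ?thesis
    using that M(1) by blast
qed

text \<open>
  The function $r$ is the farthest distance from a point to $K$. If two different points minimised it, then
  by the previous identity their midpoint would have a farthest distance that is smaller by a factor
  of at least $\kappa$ on the cosh scale. For existence, the sublevel sets of $r$ are compact and nested.
\<close>

lemma Chebyshev_centre_unique:
  fixes r :: "complex \<Rightarrow> real"
  assumes K: "K \<subseteq> unit_disc"
    and attained: "\<And>z. z \<in> unit_disc \<Longrightarrow> \<exists>w\<in>K. r z = pseudo_dist z w"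
    and bound: "\<And>z w. z \<in> unit_disc \<Longrightarrow> w \<in> K \<Longrightarrow> pseudo_dist z w \<le> r z"
  shows "\<exists>!z. z \<in> unit_disc \<and> (\<forall>z'\<in>unit_disc. r z \<le> r z')"
proof -
  have K1: "cmod w < 1" if "w \<in> K" for w
    using K that by auto
  define R where "R z = 2 / (1 - (r z)\<^sup>2) - 1" for z
  have r01: "0 \<le> r z" "r z < 1" if "z \<in> unit_disc" for z
    using attained[OF that] K1 that pseudo_dist_nonneg pseudo_dist_less_1 by force+
  have R_att: "\<exists>w\<in>K. R z = cosh_dist z w" if "z \<in> unit_disc" for z
    using attained[OF that] K1 that by (auto simp: R_def cosh_dist_eq)
  have R_bound: "cosh_dist z w \<le> R z" if z: "z \<in> unit_disc" and w: "w \<in> K" for z w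
    using attained[OF z] bound[OF z w] K1 w z
    by (auto simp: R_def cosh_dist_le_iff simp flip: cosh_dist_eq)
  have R_le: "R z \<le> R z' \<longleftrightarrow> r z \<le> r z'" if z: "z \<in> unit_disc" "z' \<in> unit_disc" for z z'
  proof -
    obtain w w' where "w \<in> K" "r z = pseudo_dist z w" "w' \<in> K" "r z' = pseudo_dist z' w'"
      using attained z by metis
    then show ?thesis
      using cosh_dist_le_iff[of z w z' w'] K1 z by (simp add: R_def cosh_dist_eq)
  qed
  have uniq: "z1 = z2" if z: "z1 \<in> unit_disc" "z2 \<in> unit_disc"
    and min: "\<forall>z'\<in>unit_disc. R z1 \<le> R z'" "\<forall>z'\<in>unit_disc. R z2 \<le> R z'" for z1 z2
  proof (rule ccontr)
    assume "z1 \<noteq> z2"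
    then obtain M \<kappa> where M: "cmod M < 1" "1 < \<kappa>"
      "\<And>w. cmod w < 1 \<Longrightarrow> cosh_dist z1 w + cosh_dist z2 w = 2 * \<kappa> * cosh_dist M w"
      using z hyperbolic_midpoint[of z1 z2] by auto
    obtain w where w: "w \<in> K" "R M = cosh_dist M w"
      using R_att[of M] M by auto
    have "2 * \<kappa> * R M \<le> R z1 + R z2"
      using M(3)[of w] w K1 R_bound[OF z(1) w(1)] R_bound[OF z(2) w(1)] by auto
    also have "\<dots> \<le> 2 * R M"
      using bspec[OF min(1), of M] bspec[OF min(2), of M] M(1) by simp
    finally have "\<kappa> * R M \<le> R M" by simp
    moreover have "1 \<le> R M"
      using w cosh_dist_ge_1[OF M(1)] K1 by auto
    ultimately show False
      using M(2) mult_strict_right_mono[of 1 \<kappa> "R M"] by simp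
  qed
  define I where "I = Inf (R ` unit_disc)"
  have bdd: "bdd_below (R ` unit_disc)"
  proof (rule bdd_belowI2)
    fix z :: complex assume "z \<in> unit_disc"
    then show "1 \<le> R z"
      using R_att[of z] cosh_dist_ge_1[of z] K1 by fastforce
  qed
  \<comment> \<open>Clearing denominators makes the sublevel sets closed in the closed disc; no boundary point satisfies the inequality.\<close>
  define L where "L n = {z \<in> cball 0 1. \<forall>w\<in>K.
      (1 + (cmod z)\<^sup>2) * (1 + (cmod w)\<^sup>2) - 4 * Re (cnj w * z)
        \<le> (I + inverse (real (Suc n))) * ((1 - (cmod z)\<^sup>2) * (1 - (cmod w)\<^sup>2))}" for n
  have L_iff: "z \<in> L n \<longleftrightarrow> z \<in> unit_disc \<and> R z \<le> I + inverse (real (Suc n))" for z n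
  proof (cases "cmod z < 1")
    case True
    have "cosh_dist z w \<le> c \<longleftrightarrow> (1 + (cmod z)\<^sup>2) * (1 + (cmod w)\<^sup>2) - 4 * Re (cnj w * z)
        \<le> c * ((1 - (cmod z)\<^sup>2) * (1 - (cmod w)\<^sup>2))" if "w \<in> K" for w c
    proof -
      have "0 < (1 - (cmod z)\<^sup>2) * (1 - (cmod w)\<^sup>2)"
        using True K1[OF that] by (simp add: abs_square_less_1)
      then show ?thesis
        by (simp add: cosh_dist_def pos_divide_le_eq)
    qed
    then have "z \<in> L n \<longleftrightarrow> (\<forall>w\<in>K. cosh_dist z w \<le> I + inverse (real (Suc n)))"
      using True by (simp add: L_def)
    also have "\<dots> \<longleftrightarrow> R z \<le> I + inverse (real (Suc n))"
      using R_att[of z] R_bound[of z] True by force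
    finally show ?thesis
      using True by simp
  next
    case False
    obtain w where w: "w \<in> K"
      using attained[of 0] by auto
    have "z \<notin> L n"
    proof
      assume z: "z \<in> L n"
      then have z1: "cmod z = 1"
        using False by (auto simp: L_def)
      have "2 * (1 + (cmod w)\<^sup>2) - 4 * Re (cnj w * z) \<le> 0"
        using z w by (force simp: L_def z1)
      moreover have "Re (cnj w * z) \<le> cmod w"
        using complex_Re_le_cmod[of "cnj w * z"] by (simp add: norm_mult z1)
      ultimately have "(1 - cmod w)\<^sup>2 \<le> 0"
        by (simp add: power2_eq_square algebra_simps)
      then show False
        using K1[OF w] by simp
    qed
    then show ?thesis
      using False by simp
  qed
  have "\<Inter>(range L) \<noteq> {}"
  proof (rule compact_nest)
    fix n
    have "L n = cball 0 1 \<inter> (\<Inter>w\<in>K. {z. (1 + (cmod z)\<^sup>2) * (1 + (cmod w)\<^sup>2) - 4 * Re (cnj w * z)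
        \<le> (I + inverse (real (Suc n))) * ((1 - (cmod z)\<^sup>2) * (1 - (cmod w)\<^sup>2))})"
      by (auto simp: L_def)
    moreover have "closed (\<Inter>w\<in>K. {z. (1 + (cmod z)\<^sup>2) * (1 + (cmod w)\<^sup>2) - 4 * Re (cnj w * z)
        \<le> (I + inverse (real (Suc n))) * ((1 - (cmod z)\<^sup>2) * (1 - (cmod w)\<^sup>2))})"
      by (intro closed_INT ballI closed_Collect_le continuous_intros)
    ultimately show "compact (L n)"
      by (simp only: compact_Int_closed compact_cball)
    have "\<exists>z\<in>unit_disc. R z < I + inverse (real (Suc n))"
      using cInf_lessD[of "R ` unit_disc" "I + inverse (real (Suc n))"] by (auto simp: I_def)
    then show "L n \<noteq> {}"
      using L_iff less_imp_le by blast
  next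
    fix m n :: nat assume "m \<le> n"
    then have "inverse (real (Suc n)) \<le> inverse (real (Suc m))"
      by (simp add: le_imp_inverse_le)
    then show "L n \<subseteq> L m"
      unfolding subset_iff L_iff by (meson add_left_mono order_trans)
  qed
  then obtain z where z: "\<And>n. z \<in> L n"
    by blast
  have zd: "z \<in> unit_disc"
    using z L_iff by blast
  have "R z \<le> I"
  proof (rule field_le_epsilon)
    fix e :: real assume "e > 0"
    then obtain n where "inverse (real (Suc n)) < e"
      using reals_Archimedean by blast
    then show "R z \<le> I + e"
      using z[of n] L_iff by force
  qed
  then have "R z \<le> R z'" if "z' \<in> unit_disc" for z'
    using cINF_lower[OF bdd that] by (simp add: I_def)
  with zd uniq show ?thesis
    by (intro ex1I[of _ z]) (auto simp: R_le)
qed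

section \<open>The magic functions\<close>

definition magic :: "complex \<Rightarrow> complex \<times> complex \<Rightarrow> complex" where
  "magic \<omega> q = (2 * \<omega> * snd q - fst q) / (2 - \<omega> * fst q)"

lemma magic_denominator_nonzero:
  assumes "q \<in> symm_bidisc" "cmod \<omega> = 1"
  shows "2 - \<omega> * fst q \<noteq> 0"
proof
  assume *: "2 - \<omega> * fst q = 0"
  obtain z w where "q = (z + w, z * w)" "cmod z < 1" "cmod w < 1"
    using assms(1) by (auto simp: symm_bidisc_def)
  then have "cmod (\<omega> * fst q) < 2"
    using norm_triangle_ineq[of z w] assms(2) by (simp add: norm_mult)
  with * show False
    by (metis eq_iff_diff_eq_0 less_irrefl norm_numeral)
qed

text \<open>
  The squared moduli of the denominator and of the numerator differ by four times
  $1 - |p|^2 - \mathrm{Re}(\omega d)$ with $d = s - \bar s p$. Writing $d$ in terms of the roots $z$ and $w$ gives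
  $|d| \le (|z|+|w|)(1-|zw|) < (1+|zw|)(1-|zw|)$.
\<close>

lemma magic_in_disc:
  assumes q: "q \<in> symm_bidisc" and \<omega>: "cmod \<omega> = 1"
  shows "cmod (magic \<omega> q) < 1"
proof -
  obtain z w where zw: "q = (z + w, z * w)" "cmod z < 1" "cmod w < 1"
    using q by (auto simp: symm_bidisc_def)
  have \<omega>2: "(Re \<omega>)\<^sup>2 + (Im \<omega>)\<^sup>2 = 1"
    using \<omega> by (metis cmod_power2 one_power2)
  define d where "d = z * of_real (1 - (cmod w)\<^sup>2) + w * of_real (1 - (cmod z)\<^sup>2)"
  have pos: "0 < 1 - (cmod w)\<^sup>2" "0 < 1 - (cmod z)\<^sup>2"
    using zw by (auto simp: abs_square_less_1)
  have "cmod d \<le> cmod z * (1 - (cmod w)\<^sup>2) + cmod w * (1 - (cmod z)\<^sup>2)"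
    unfolding d_def using norm_triangle_ineq[of "z * of_real (1 - (cmod w)\<^sup>2)" "w * of_real (1 - (cmod z)\<^sup>2)"] pos
    by (simp add: norm_mult del: of_real_diff)
  also have "\<dots> = (cmod z + cmod w) * (1 - cmod z * cmod w)"
    by (simp add: algebra_simps power2_eq_square)
  also have "\<dots> < (1 + cmod z * cmod w) * (1 - cmod z * cmod w)"
  proof (rule mult_strict_right_mono)
    have "0 < (1 - cmod z) * (1 - cmod w)"
      using zw by simp
    then show "cmod z + cmod w < 1 + cmod z * cmod w"
      by (simp add: algebra_simps)
    show "0 < 1 - cmod z * cmod w"
      using zw mult_strict_mono'[of "cmod z" 1 "cmod w" 1] by simp
  qed
  finally have d: "cmod d < 1 - (cmod z)\<^sup>2 * (cmod w)\<^sup>2"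
    by (simp add: algebra_simps power2_eq_square)
  have "(cmod (2 - \<omega> * (z + w)))\<^sup>2 - (cmod (2 * \<omega> * (z * w) - (z + w)))\<^sup>2
     = 4 + ((Re \<omega>)\<^sup>2 + (Im \<omega>)\<^sup>2 - 1) * (cmod (z + w))\<^sup>2 - 4 * ((Re \<omega>)\<^sup>2 + (Im \<omega>)\<^sup>2) * ((cmod z)\<^sup>2 * (cmod w)\<^sup>2) - 4 * Re (\<omega> * d)"
    unfolding cmod_power2 d_def by (simp add: algebra_simps power2_eq_square)
  also have "\<dots> = 4 * (1 - (cmod z)\<^sup>2 * (cmod w)\<^sup>2 - Re (\<omega> * d))"
    unfolding \<omega>2 by simp
  also have "\<dots> > 0"
    using d complex_Re_le_cmod[of "\<omega> * d"] \<omega> by (simp add: norm_mult)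
  finally have "cmod (2 * \<omega> * (z * w) - (z + w)) < cmod (2 - \<omega> * (z + w))"
    by (intro power2_less_imp_less[of _ "cmod (2 - \<omega> * (z + w))"]) auto
  then show ?thesis
    using zw(1) by (auto simp: magic_def norm_divide divide_simps)
qed

lemma magic_holomorphic_on_C2:
  assumes \<omega>: "cmod \<omega> = 1"
  shows "holomorphic_on_C2 (magic \<omega>) symm_bidisc"
  unfolding holomorphic_on_C2_def
proof
  fix q assume "q \<in> symm_bidisc"
  then have D: "2 - \<omega> * fst q \<noteq> 0"
    using magic_denominator_nonzero \<omega> by blast
  have quotient: "((2 * \<omega> * v - u) * D - N * (0 - \<omega> * u)) / (D * D)
      = (N * \<omega> - D) / (D * D) * u + 2 * \<omega> * D / (D * D) * v" for u v N D :: complex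
    by (cases "D = 0") (simp_all add: field_simps)
  let ?N = "2 * \<omega> * snd q - fst q" and ?D = "2 - \<omega> * fst q"
  have "((\<lambda>q. (2 * \<omega> * snd q - fst q) / (2 - \<omega> * fst q)) has_derivative
      (\<lambda>h. ((2 * \<omega> * snd h - fst h) * ?D - ?N * (0 - \<omega> * fst h)) / (?D * ?D))) (at q within symm_bidisc)"
    by (intro has_derivative_divide' has_derivative_diff has_derivative_mult_right has_derivative_fst
        has_derivative_snd has_derivative_const has_derivative_ident D)
  moreover have "(\<lambda>h. ((2 * \<omega> * snd h - fst h) * ?D - ?N * (0 - \<omega> * fst h)) / (?D * ?D))
      = (\<lambda>(u, v). (?N * \<omega> - ?D) / (?D * ?D) * u + 2 * \<omega> * ?D / (?D * ?D) * v)"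
    unfolding quotient by (simp only: case_prod_beta')
  ultimately have "(magic \<omega> has_derivative
      (\<lambda>(u, v). (?N * \<omega> - ?D) / (?D * ?D) * u + 2 * \<omega> * ?D / (?D * ?D) * v)) (at q within symm_bidisc)"
    by (simp add: magic_def[abs_def])
  then show "\<exists>a b. (magic \<omega> has_derivative (\<lambda>(u, v). a * u + b * v)) (at q within symm_bidisc)"
    by blast
qed

lemma holomorphic_on_C2_compose:
  assumes f: "holomorphic_on_C2 f S"
    and h: "(\<lambda>z. fst (h z)) holomorphic_on A" "(\<lambda>z. snd (h z)) holomorphic_on A" "h ` A \<subseteq> S"
  shows "(\<lambda>z. f (h z)) holomorphic_on A"
  unfolding holomorphic_on_def
proof
  fix z assume z: "z \<in> A"
  obtain d1 d2 where d: "((\<lambda>z. fst (h z)) has_field_derivative d1) (at z within A)"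
     "((\<lambda>z. snd (h z)) has_field_derivative d2) (at z within A)"
    using h z by (meson field_differentiable_def holomorphic_on_def)
  then have hd: "(h has_derivative (\<lambda>t. (d1 * t, d2 * t))) (at z within A)"
    using has_derivative_Pair[of "\<lambda>z. fst (h z)" "(*) d1" z A "\<lambda>z. snd (h z)" "(*) d2"]
    by (simp add: has_field_derivative_def)
  obtain a b where "(f has_derivative (\<lambda>(u, v). a * u + b * v)) (at (h z) within S)"
    using f h(3) z unfolding holomorphic_on_C2_def by blast
  then have "(f has_derivative (\<lambda>(u, v). a * u + b * v)) (at (h z) within h ` A)"
    using h(3) has_derivative_subset by blast
  from has_derivative_in_compose[OF hd this]
  have "((\<lambda>z. f (h z)) has_derivative (\<lambda>t. (a * d1 + b * d2) * t)) (at z within A)"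
    by (simp add: algebra_simps)
  then show "(\<lambda>z. f (h z)) field_differentiable at z within A"
    unfolding field_differentiable_def has_field_derivative_def by blast
qed

section \<open>Half-plane coordinates\<close>

definition cayley :: "complex \<Rightarrow> complex" where
  "cayley a = (a - \<i>) / (a + \<i>)"

lemma plus_ii_nonzero: "0 < Im a \<Longrightarrow> a + \<i> \<noteq> 0"
  by (auto simp: complex_eq_iff)

lemma cayley_inject:
  assumes "cayley a = cayley b" "0 < Im a" "0 < Im b"
  shows "a = b"
proof -
  have nz: "a + \<i> \<noteq> 0" "b + \<i> \<noteq> 0"
    using assms plus_ii_nonzero by auto
  have "cayley a = 1 - 2 * \<i> / (a + \<i>)" "cayley b = 1 - 2 * \<i> / (b + \<i>)"
    using nz by (simp_all add: cayley_def field_simps)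
  then have "2 * \<i> / (a + \<i>) = 2 * \<i> / (b + \<i>)"
    using assms(1) by (metis diff_diff_eq2 add_diff_cancel_left')
  then have "2 * \<i> * (b + \<i>) = 2 * \<i> * (a + \<i>)"
    by (simp only: frac_eq_eq[OF nz])
  then show ?thesis
    by simp
qed

lemma cmod_cayley_less_1_iff:
  assumes "a + \<i> \<noteq> 0" shows "cmod (cayley a) < 1 \<longleftrightarrow> 0 < Im a"
proof -
  have "cmod (cayley a) < 1 \<longleftrightarrow> (cmod (a - \<i>))\<^sup>2 < (cmod (a + \<i>))\<^sup>2"
    using assms abs_le_square_iff[of "cmod (a + \<i>)" "cmod (a - \<i>)"]
    by (simp add: cayley_def norm_divide not_le[symmetric])
  also have "\<dots> \<longleftrightarrow> 0 < Im a"
    unfolding cmod_power2 by (simp add: algebra_simps power2_eq_square)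
  finally show ?thesis .
qed

lemma cayley_surj:
  assumes "cmod z < 1"
  obtains a where "0 < Im a" "cayley a = z"
proof -
  have z: "1 - z \<noteq> 0"
    using assms by auto
  define a where "a = \<i> * (1 + z) / (1 - z)"
  have a: "a + \<i> = 2 * \<i> / (1 - z)" "a - \<i> = 2 * \<i> * z / (1 - z)"
    using z by (auto simp: a_def field_simps)
  have "cayley a = z"
    using z unfolding cayley_def a by simp
  moreover have "0 < Im a"
    using cmod_cayley_less_1_iff[of a] a(1) z assms calculation by simp
  ultimately show ?thesis
    using that by blast
qed

lemma pseudo_dist_cayley:
  assumes "0 < Im a" "0 < Im b"
  shows "pseudo_dist (- cayley a) (- cayley b) = cmod (a - b) / cmod (a - cnj b)"
proof -
  have nz: "a + \<i> \<noteq> 0" "b + \<i> \<noteq> 0" "cnj b - \<i> \<noteq> 0"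
    using assms plus_ii_nonzero[of a] plus_ii_nonzero[of b] by (auto simp: complex_eq_iff)
  have 1: "- cayley a - - cayley b = 2 * \<i> * (b - a) / ((a + \<i>) * (b + \<i>))"
    using nz by (simp add: cayley_def field_simps)
  have "1 - cnj (- cayley b) * - cayley a = 1 - (cnj b + \<i>) * (a - \<i>) / ((cnj b - \<i>) * (a + \<i>))"
    by (simp add: cayley_def)
  also have "\<dots> = ((cnj b - \<i>) * (a + \<i>) - (cnj b + \<i>) * (a - \<i>)) / ((cnj b - \<i>) * (a + \<i>))"
    using nz by (simp add: diff_divide_distrib)
  also have "(cnj b - \<i>) * (a + \<i>) - (cnj b + \<i>) * (a - \<i>) = 2 * \<i> * (cnj b - a)"
    by (simp add: algebra_simps)
  finally have 2: "1 - cnj (- cayley b) * - cayley a = 2 * \<i> * (cnj b - a) / ((cnj b - \<i>) * (a + \<i>))" .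
  have 3: "cmod (cnj b - \<i>) = cmod (b + \<i>)"
    by (metis complex_cnj_add complex_cnj_i complex_mod_cnj diff_conv_add_uminus)
  show ?thesis
    unfolding pseudo_dist_def 1 2 using nz
    by (simp add: norm_divide norm_mult 3 norm_minus_commute[of "cnj b" a] norm_minus_commute[of b a])
qed

lemma pseudo_dist_cayley_le_iff:
  assumes "0 < Im a" "0 < Im b" "0 < Im a'" "0 < Im b'"
  shows "pseudo_dist (- cayley a) (- cayley b) \<le> pseudo_dist (- cayley a') (- cayley b') \<longleftrightarrow>
    (cmod (a - b))\<^sup>2 * (Im a' * Im b') \<le> (cmod (a' - b'))\<^sup>2 * (Im a * Im b)"
proof -
  have sq: "(cmod (a - cnj b))\<^sup>2 = (cmod (a - b))\<^sup>2 + 4 * (Im a * Im b)" for a b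
    unfolding cmod_power2 by (simp add: algebra_simps power2_eq_square)
  have pos: "0 < Im a * Im b" "0 < Im a' * Im b'"
    using assms by auto
  have "pseudo_dist (- cayley a) (- cayley b) \<le> pseudo_dist (- cayley a') (- cayley b') \<longleftrightarrow>
     (cmod (a - b) / cmod (a - cnj b))\<^sup>2 \<le> (cmod (a' - b') / cmod (a' - cnj b'))\<^sup>2"
    using assms by (simp add: pseudo_dist_cayley abs_le_square_iff[symmetric])
  also have "\<dots> \<longleftrightarrow> (cmod (a - b))\<^sup>2 / ((cmod (a - b))\<^sup>2 + 4 * (Im a * Im b))
     \<le> (cmod (a' - b'))\<^sup>2 / ((cmod (a' - b'))\<^sup>2 + 4 * (Im a' * Im b'))"
    by (simp add: power_divide sq)
  also have "\<dots> \<longleftrightarrow> (cmod (a - b))\<^sup>2 * ((cmod (a' - b'))\<^sup>2 + 4 * (Im a' * Im b'))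
     \<le> (cmod (a' - b'))\<^sup>2 * ((cmod (a - b))\<^sup>2 + 4 * (Im a * Im b))"
  proof -
    have "0 < (cmod (a - b))\<^sup>2 + 4 * (Im a * Im b)" "0 < (cmod (a' - b'))\<^sup>2 + 4 * (Im a' * Im b')"
      using pos by (auto intro!: add_nonneg_pos)
    then show ?thesis
      by (simp add: pos_divide_le_eq) (simp add: pos_le_divide_eq mult.commute)
  qed
  finally show ?thesis
    by (simp add: algebra_simps)
qed

definition chart_denom :: "complex \<Rightarrow> complex \<Rightarrow> complex" where
  "chart_denom m Q = (m + \<i>)\<^sup>2 - Q"

text \<open>
  The point $(s,p)$ whose roots, moved to the half-plane, are $m \pm \sqrt Q$. The mean and the squared half
  difference of the roots are symmetric in them, so no choice of a square root enters.
\<close>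

definition chart :: "complex \<Rightarrow> complex \<Rightarrow> complex \<times> complex" where
  "chart m Q = (2 * (m\<^sup>2 - Q + 1) / chart_denom m Q, ((m - \<i>)\<^sup>2 - Q) / chart_denom m Q)"

lemma chart_mean_discriminant:
  assumes "0 < Im Z" "0 < Im W" "m = (Z + W) / 2" "Q = ((Z - W) / 2)\<^sup>2"
  shows "chart m Q = (cayley Z + cayley W, cayley Z * cayley W)" "chart_denom m Q \<noteq> 0"
proof -
  have nz: "Z + \<i> \<noteq> 0" "W + \<i> \<noteq> 0"
    using assms plus_ii_nonzero by auto
  define d where "d = (Z - W) / 2"
  have Z: "Z = m + d" and W: "W = m - d"
    unfolding assms d_def by (auto simp: field_simps)
  have Q: "Q = d\<^sup>2"
    by (simp add: assms d_def)
  have den: "chart_denom m Q = (Z + \<i>) * (W + \<i>)"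
    unfolding Z W Q by (simp add: chart_denom_def power2_eq_square algebra_simps)
  then show "chart_denom m Q \<noteq> 0"
    using nz by simp
  have num: "(m - \<i>)\<^sup>2 - Q = (Z - \<i>) * (W - \<i>)"
    unfolding Z W Q by (simp add: power2_eq_square algebra_simps)
  have "2 * (m\<^sup>2 - Q + 1) = (m + \<i>)\<^sup>2 - Q + ((m - \<i>)\<^sup>2 - Q) + 4"
    by (simp add: power2_eq_square algebra_simps)
  also have "\<dots> = (Z + \<i>) * (W + \<i>) + (Z - \<i>) * (W - \<i>) + 4"
    using den num by (simp add: chart_denom_def)
  also have "\<dots> = (Z - \<i>) * (W + \<i>) + (W - \<i>) * (Z + \<i>)"
    by (simp add: algebra_simps)
  finally show "chart m Q = (cayley Z + cayley W, cayley Z * cayley W)"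
    using nz by (simp add: chart_def den num cayley_def add_frac_eq)
qed

text \<open>
  The quantity $|Q| - \mathrm{Re}\, Q$ is twice the square of $\mathrm{Im} \sqrt Q$, so the hypothesis keeps both
  $m + \sqrt Q$ and $m - \sqrt Q$ in the half-plane.
\<close>

lemma chart_in_symm_bidisc:
  assumes "0 < Im m" "cmod Q - Re Q < 2 * (Im m)\<^sup>2"
  shows "chart m Q \<in> symm_bidisc" "chart_denom m Q \<noteq> 0"
proof -
  define r where "r = csqrt Q"
  have r: "r\<^sup>2 = Q"
    by (simp add: r_def)
  have "cmod Q = (Re r)\<^sup>2 + (Im r)\<^sup>2"
    by (metis cmod_power2 norm_power r)
  moreover have "Re Q = (Re r)\<^sup>2 - (Im r)\<^sup>2"
    unfolding r[symmetric] by (simp add: power2_eq_square)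
  ultimately have "(Im r)\<^sup>2 < (Im m)\<^sup>2"
    using assms(2) by simp
  then have "\<bar>Im r\<bar> < Im m"
    using assms(1) by (intro power2_less_imp_less[of "\<bar>Im r\<bar>"]) auto
  then have Z: "0 < Im (m + r)" and W: "0 < Im (m - r)"
    by auto
  have *: "m = ((m + r) + (m - r)) / 2" "Q = (((m + r) - (m - r)) / 2)\<^sup>2"
    using r by auto
  have "cmod (cayley (m + r)) < 1" "cmod (cayley (m - r)) < 1"
    using Z W cmod_cayley_less_1_iff plus_ii_nonzero by auto
  then show "chart m Q \<in> symm_bidisc"
    using chart_mean_discriminant(1)[OF Z W *] unfolding symm_bidisc_def by auto
  show "chart_denom m Q \<noteq> 0"
    using chart_mean_discriminant(2)[OF Z W *] .
qed

lemma symm_bidisc_chart: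
  assumes "q \<in> symm_bidisc"
  obtains m Q where "0 < Im m" "chart_denom m Q \<noteq> 0" "q = chart m Q"
proof -
  obtain z w where zw: "q = (z + w, z * w)" "cmod z < 1" "cmod w < 1"
    using assms by (auto simp: symm_bidisc_def)
  obtain Z W where ZW: "0 < Im Z" "cayley Z = z" "0 < Im W" "cayley W = w"
    using cayley_surj zw by metis
  show ?thesis
    using that[of "(Z + W) / 2" "((Z - W) / 2)\<^sup>2"] chart_mean_discriminant[OF ZW(1,3) refl refl] ZW zw
    by auto
qed

lemma magic_1_chart:
  assumes "chart_denom m Q \<noteq> 0" "0 < Im m"
  shows "magic 1 (chart m Q) = - cayley m"
proof -
  have m: "m + \<i> \<noteq> 0"
    using assms plus_ii_nonzero by blast
  define D where "D = chart_denom m Q"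
  have D: "D \<noteq> 0" "D = (m + \<i>)\<^sup>2 - Q"
    using assms by (auto simp: D_def chart_denom_def)
  have "2 * snd (chart m Q) - fst (chart m Q) = (2 * ((m - \<i>)\<^sup>2 - Q) - 2 * (m\<^sup>2 - Q + 1)) / D"
    unfolding chart_def D_def[symmetric] diff_divide_distrib[of "2 * ((m - \<i>)\<^sup>2 - Q)"] by simp
  moreover have "2 * ((m - \<i>)\<^sup>2 - Q) - 2 * (m\<^sup>2 - Q + 1) = - 4 * \<i> * (m - \<i>)"
    by (simp add: power2_eq_square algebra_simps)
  moreover have "2 - fst (chart m Q) = (2 * D - 2 * (m\<^sup>2 - Q + 1)) / D"
    unfolding chart_def D_def[symmetric] using D(1) by (simp add: diff_divide_distrib)
  moreover have "2 * D - 2 * (m\<^sup>2 - Q + 1) = 4 * \<i> * (m + \<i>)"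
    by (simp add: D(2) power2_eq_square algebra_simps)
  ultimately show ?thesis
    using D(1) m by (simp add: magic_def cayley_def)
qed

text \<open>
  If the boundary point $x$ is sent to infinity by $\zeta \mapsto -1/(\zeta - x)$, this is the mean of the images
  of the roots, transported back to the original half-plane. So it belongs to $x$ as $m$ belongs to infinity.
\<close>

definition halfplane_magic :: "real \<Rightarrow> complex \<Rightarrow> complex \<Rightarrow> complex" where
  "halfplane_magic x m Q = m - Q / (m - of_real x)"

text \<open>
  The boundary point $x$ of the half-plane corresponds to the conjugate of $\omega$ under the Cayley transform.
  The second claim is there only to exclude a degenerate value inside $G$, where the denominator of
  a magic function does not vanish.
\<close>

lemma magic_chart:
  assumes D0: "chart_denom m Q \<noteq> 0" and m: "0 < Im m"
    and \<omega>: "\<omega> = (of_real x + \<i>) / (of_real x - \<i>)"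
  shows "magic \<omega> (chart m Q) = - cayley (halfplane_magic x m Q)"
    and "halfplane_magic x m Q + \<i> = 0 \<Longrightarrow> 2 - \<omega> * fst (chart m Q) = 0"
proof -
  define D where "D = chart_denom m Q"
  have D: "D \<noteq> 0" "D = (m + \<i>)\<^sup>2 - Q"
    using D0 by (auto simp: D_def chart_denom_def)
  define X where "X = complex_of_real x"
  define v where "v = m - X"
  have X: "X - \<i> \<noteq> 0" and v: "v \<noteq> 0"
    using m by (auto simp: X_def v_def complex_eq_iff)
  define y where "y = halfplane_magic x m Q"
  have y: "v * y = v * m - Q"
    using v by (simp add: y_def halfplane_magic_def X_def[symmetric] v_def[symmetric] field_simps)
  have "2 * \<omega> * snd (chart m Q) - fst (chart m Q)
      = (2 * (X + \<i>) * ((m - \<i>)\<^sup>2 - Q) - (X - \<i>) * (2 * (m\<^sup>2 - Q + 1))) / ((X - \<i>) * D)"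
    unfolding chart_def D_def[symmetric] \<omega> X_def[symmetric] using D(1) X by (simp add: field_simps)
  also have "2 * (X + \<i>) * ((m - \<i>)\<^sup>2 - Q) - (X - \<i>) * (2 * (m\<^sup>2 - Q + 1)) = 4 * \<i> * (v * m - Q - v * \<i>)"
    unfolding v_def by (simp add: power2_eq_square algebra_simps)
  also have "v * m - Q - v * \<i> = v * (y - \<i>)"
    by (simp only: ring_distribs y)
  finally have N: "2 * \<omega> * snd (chart m Q) - fst (chart m Q) = 4 * \<i> * (v * (y - \<i>)) / ((X - \<i>) * D)" .
  have "2 - \<omega> * fst (chart m Q)
      = (2 * ((X - \<i>) * D) - (X + \<i>) * (2 * (m\<^sup>2 - Q + 1))) / ((X - \<i>) * D)"
    unfolding chart_def D_def[symmetric] \<omega> X_def[symmetric] using D(1) X by (simp add: field_simps)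
  also have "2 * ((X - \<i>) * D) - (X + \<i>) * (2 * (m\<^sup>2 - Q + 1)) = - 4 * \<i> * (v * m - Q + v * \<i>)"
    unfolding v_def D(2) by (simp add: power2_eq_square algebra_simps)
  also have "v * m - Q + v * \<i> = v * (y + \<i>)"
    by (simp only: ring_distribs y)
  finally have M: "2 - \<omega> * fst (chart m Q) = - 4 * \<i> * (v * (y + \<i>)) / ((X - \<i>) * D)" .
  show "magic \<omega> (chart m Q) = - cayley (halfplane_magic x m Q)"
    unfolding magic_def N M y_def[symmetric] cayley_def using X D(1) v by simp
  show "2 - \<omega> * fst (chart m Q) = 0" if "halfplane_magic x m Q + \<i> = 0"
    using that unfolding M y_def[symmetric] by simp
qed

lemma cmod_real_plus_ii_quotient: "cmod ((of_real x + \<i>) / (of_real x - \<i>)) = 1"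
proof -
  have "cmod (of_real x + \<i>) = cmod (of_real x - \<i>)" "of_real x - \<i> \<noteq> 0"
    by (auto simp: cmod_def complex_eq_iff)
  then show ?thesis
    by (simp add: norm_divide)
qed

lemma halfplane_magic_pos:
  assumes "chart m Q \<in> symm_bidisc" "chart_denom m Q \<noteq> 0" "0 < Im m"
  shows "0 < Im (halfplane_magic x m Q)"
proof -
  define \<omega> where "\<omega> = (of_real x + \<i>) / (of_real x - \<i>)"
  have \<omega>: "cmod \<omega> = 1"
    by (simp add: \<omega>_def cmod_real_plus_ii_quotient)
  have eq: "magic \<omega> (chart m Q) = - cayley (halfplane_magic x m Q)"
    using magic_chart(1)[OF assms(2,3) \<omega>_def] .
  have "halfplane_magic x m Q + \<i> \<noteq> 0"
    using magic_chart(2)[OF assms(2,3) \<omega>_def] magic_denominator_nonzero[OF assms(1) \<omega>] by blast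
  then show ?thesis
    using cmod_cayley_less_1_iff magic_in_disc[OF assms(1) \<omega>] eq by simp
qed

section \<open>Two points for which $\Phi_1$ is extremal\<close>

lemma cubic_nonneg_imp_leading_zero:
  fixes p0 p1 p2 p3 :: real
  assumes "\<And>x. 0 \<le> p0 + p1 * x + p2 * x\<^sup>2 + p3 * x ^ 3"
  shows "p3 = 0"
proof (rule ccontr)
  assume "p3 \<noteq> 0"
  define K where "K = \<bar>p0\<bar> + \<bar>p1\<bar> + \<bar>p2\<bar>"
  define T where "T = K / \<bar>p3\<bar> + 1"
  have "K \<ge> 0"
    by (simp add: K_def)
  then have T: "1 \<le> T"
    by (simp add: T_def)
  have "\<bar>p3\<bar> * T ^ 3 \<le> \<bar>p0\<bar> + \<bar>p1\<bar> * T + \<bar>p2\<bar> * T\<^sup>2"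
  proof -
    have "\<bar>p1 * T\<bar> = \<bar>p1\<bar> * T" "\<bar>p2 * T\<^sup>2\<bar> = \<bar>p2\<bar> * T\<^sup>2"
      using T by (auto simp: abs_mult)
    then show ?thesis
      using assms[of T] assms[of "- T"] by (cases "0 \<le> p3") auto
  qed
  also have "\<dots> \<le> \<bar>p0\<bar> * T\<^sup>2 + \<bar>p1\<bar> * T\<^sup>2 + \<bar>p2\<bar> * T\<^sup>2"
  proof -
    have "1 \<le> T\<^sup>2" "T \<le> T\<^sup>2"
      using T one_le_power[of T 2] by (auto simp: power2_eq_square)
    then show ?thesis
      by (intro add_mono mult_left_mono mult_left_mono[of 1 "T\<^sup>2" "\<bar>p0\<bar>", simplified]) auto
  qed
  also have "\<dots> = K * T\<^sup>2"
    by (simp add: K_def algebra_simps)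
  finally have "(\<bar>p3\<bar> * T) * T\<^sup>2 \<le> K * T\<^sup>2"
    by (simp add: power3_eq_cube power2_eq_square mult.assoc)
  then have "\<bar>p3\<bar> * T \<le> K"
    using T by (simp add: mult_le_cancel_right)
  moreover have "\<bar>p3\<bar> * T = K + \<bar>p3\<bar>"
    using \<open>p3 \<noteq> 0\<close> by (simp add: T_def field_simps)
  ultimately show False
    using \<open>p3 \<noteq> 0\<close> by simp
qed

lemma cmod_quadratic_sq:
  fixes x :: real
  shows "(cmod (\<alpha> * (of_real x)\<^sup>2 + \<beta> * of_real x + \<gamma>))\<^sup>2
    = (cmod \<alpha>)\<^sup>2 * x ^ 4 + 2 * Re (cnj \<alpha> * \<beta>) * x ^ 3
      + ((cmod \<beta>)\<^sup>2 + 2 * Re (cnj \<alpha> * \<gamma>)) * x\<^sup>2 + 2 * Re (cnj \<beta> * \<gamma>) * x + (cmod \<gamma>)\<^sup>2"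
  unfolding cmod_power2 by (simp add: power2_eq_square power3_eq_cube power4_eq_xxxx algebra_simps)

lemma Im_halfplane_magic:
  assumes "0 < Im m"
  shows "Im (halfplane_magic x m Q) * (cmod (m - of_real x))\<^sup>2
    = Im m * x\<^sup>2 + (Im Q - 2 * Im m * Re m) * x + (Im m * (cmod m)\<^sup>2 + Re Q * Im m - Im Q * Re m)"
proof -
  define v where "v = m - complex_of_real x"
  have "v \<noteq> 0"
    using assms by (auto simp: v_def complex_eq_iff)
  then have "Q / v * of_real ((cmod v)\<^sup>2) = Q * cnj v"
    unfolding complex_norm_square by simp
  then have "halfplane_magic x m Q * of_real ((cmod v)\<^sup>2) = m * of_real ((cmod v)\<^sup>2) - Q * cnj v"
    by (simp add: halfplane_magic_def v_def[symmetric] algebra_simps)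
  then have "Im (halfplane_magic x m Q) * (cmod v)\<^sup>2 = Im (m * of_real ((cmod v)\<^sup>2) - Q * cnj v)"
    by (metis Im_complex_of_real Re_complex_of_real add_0_right times_complex.sel(2) mult_zero_right add_0)
  also have "\<dots> = Im m * (cmod v)\<^sup>2 - Im (Q * cnj v)"
    by simp
  finally show ?thesis
    unfolding v_def cmod_power2 by (simp add: power2_eq_square algebra_simps)
qed

text \<open>
  In half-plane coordinates: the function attached to the boundary point at infinity separates the two
  points at least as well as the function attached to any finite $x$. Here $|a-b|^2$ divided by the product
  of the imaginary parts is used as an increasing function of the hyperbolic distance.
\<close>

definition infinity_maximal :: "complex \<Rightarrow> complex \<Rightarrow> complex \<Rightarrow> complex \<Rightarrow> bool" where
  "infinity_maximal m1 Q1 m2 Q2 \<longleftrightarrow>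
    (\<forall>x. (cmod (halfplane_magic x m1 Q1 - halfplane_magic x m2 Q2))\<^sup>2 * (Im m1 * Im m2)
      \<le> (cmod (m1 - m2))\<^sup>2 * (Im (halfplane_magic x m1 Q1) * Im (halfplane_magic x m2 Q2)))"

text \<open>
  After multiplication by $|m_1-x|^2 |m_2-x|^2$ the maximality condition says that a polynomial in $x$ is
  nonnegative on the real line. Its terms of degree four cancel, so it is a cubic and its leading
  coefficient must vanish. This is the first-order condition for a maximum at infinity.
\<close>

lemma infinity_maximal_first_order:
  assumes m: "0 < Im m1" "0 < Im m2" and max: "infinity_maximal m1 Q1 m2 Q2"
  shows "(cmod (m1 - m2))\<^sup>2 * (Im m1 * Im Q2 + Im m2 * Im Q1)
    = 2 * (Im m1 * Im m2) * Re (cnj (m1 - m2) * (Q1 - Q2))"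
proof -
  define \<alpha> where "\<alpha> = m1 - m2"
  define \<beta> where "\<beta> = (Q1 - Q2) - \<alpha> * (m1 + m2)"
  define \<gamma> where "\<gamma> = \<alpha> * m1 * m2 - Q1 * m2 + Q2 * m1"
  define b where "b m Q = Im Q - 2 * Im m * Re m" for m Q
  define c where "c m Q = Im m * (cmod m)\<^sup>2 + Re Q * Im m - Im Q * Re m" for m Q
  define Y where "Y = Im m1 * Im m2"
  define N where "N = (cmod \<alpha>)\<^sup>2"
  define p3 where "p3 = N * (Im m1 * b m2 Q2 + Im m2 * b m1 Q1) - Y * (2 * Re (cnj \<alpha> * \<beta>))"
  have "p3 = 0"
  proof (rule cubic_nonneg_imp_leading_zero)
    fix x :: real
    define v1 where "v1 = m1 - complex_of_real x"
    define v2 where "v2 = m2 - complex_of_real x"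
    have v: "v1 \<noteq> 0" "v2 \<noteq> 0"
      using m by (auto simp: v1_def v2_def complex_eq_iff)
    let ?h1 = "halfplane_magic x m1 Q1" and ?h2 = "halfplane_magic x m2 Q2"
    have "(?h1 - ?h2) * (v1 * v2) = \<alpha> * (of_real x)\<^sup>2 + \<beta> * of_real x + \<gamma>"
    proof -
      have "(?h1 - ?h2) * (v1 * v2) = \<alpha> * (v1 * v2) - Q1 * v2 + Q2 * v1"
        using v by (simp add: halfplane_magic_def v1_def[symmetric] v2_def[symmetric] \<alpha>_def field_simps)
      also have "\<dots> = \<alpha> * (of_real x)\<^sup>2 + \<beta> * of_real x + \<gamma>"
        by (simp add: v1_def v2_def \<beta>_def \<gamma>_def algebra_simps power2_eq_square)
      finally show ?thesis .
    qed
    then have 1: "(cmod (?h1 - ?h2))\<^sup>2 * ((cmod v1)\<^sup>2 * (cmod v2)\<^sup>2)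
        = (cmod (\<alpha> * (of_real x)\<^sup>2 + \<beta> * of_real x + \<gamma>))\<^sup>2"
      by (metis norm_mult power_mult_distrib)
    have "0 \<le> (N * (Im ?h1 * Im ?h2) - (cmod (?h1 - ?h2))\<^sup>2 * Y) * ((cmod v1)\<^sup>2 * (cmod v2)\<^sup>2)"
      using max unfolding infinity_maximal_def N_def Y_def \<alpha>_def by (intro mult_nonneg_nonneg) auto
    also have "\<dots> = N * ((Im ?h1 * (cmod v1)\<^sup>2) * (Im ?h2 * (cmod v2)\<^sup>2))
        - Y * ((cmod (?h1 - ?h2))\<^sup>2 * ((cmod v1)\<^sup>2 * (cmod v2)\<^sup>2))"
      by (simp add: algebra_simps)
    also have "\<dots> = N * ((Im m1 * x\<^sup>2 + b m1 Q1 * x + c m1 Q1) * (Im m2 * x\<^sup>2 + b m2 Q2 * x + c m2 Q2))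
        - Y * (N * x ^ 4 + 2 * Re (cnj \<alpha> * \<beta>) * x ^ 3
      + ((cmod \<beta>)\<^sup>2 + 2 * Re (cnj \<alpha> * \<gamma>)) * x\<^sup>2 + 2 * Re (cnj \<beta> * \<gamma>) * x + (cmod \<gamma>)\<^sup>2)"
      unfolding 1 cmod_quadratic_sq unfolding v1_def v2_def Im_halfplane_magic[OF m(1)] Im_halfplane_magic[OF m(2)]
        b_def c_def N_def ..
    also have "\<dots> = (N * (c m1 Q1 * c m2 Q2) - Y * (cmod \<gamma>)\<^sup>2)
        + (N * (b m1 Q1 * c m2 Q2 + b m2 Q2 * c m1 Q1) - Y * (2 * Re (cnj \<beta> * \<gamma>))) * x
        + (N * (Im m1 * c m2 Q2 + b m1 Q1 * b m2 Q2 + c m1 Q1 * Im m2)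
            - Y * ((cmod \<beta>)\<^sup>2 + 2 * Re (cnj \<alpha> * \<gamma>))) * x\<^sup>2
        + p3 * x ^ 3"
      unfolding p3_def Y_def by (simp only: power2_eq_square[of x] power3_eq_cube[of x] power4_eq_xxxx[of x]) (simp only: algebra_simps)
    finally show "0 \<le> (N * (c m1 Q1 * c m2 Q2) - Y * (cmod \<gamma>)\<^sup>2)
        + (N * (b m1 Q1 * c m2 Q2 + b m2 Q2 * c m1 Q1) - Y * (2 * Re (cnj \<beta> * \<gamma>))) * x
        + (N * (Im m1 * c m2 Q2 + b m1 Q1 * b m2 Q2 + c m1 Q1 * Im m2)
            - Y * ((cmod \<beta>)\<^sup>2 + 2 * Re (cnj \<alpha> * \<gamma>))) * x\<^sup>2
        + p3 * x ^ 3" .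
  qed
  have "cnj \<alpha> * \<beta> = cnj \<alpha> * (Q1 - Q2) - of_real N * (m1 + m2)"
    unfolding \<beta>_def N_def complex_norm_square by (simp add: algebra_simps)
  then have R: "Re (cnj \<alpha> * \<beta>) = Re (cnj \<alpha> * (Q1 - Q2)) - N * (Re m1 + Re m2)"
    by (metis Re_complex_of_real minus_complex.sel(1) plus_complex.sel(1) scaleR_complex.sel(1) scaleR_conv_of_real)
  show ?thesis
    using \<open>p3 = 0\<close>
    unfolding p3_def R b_def Y_def \<alpha>_def[symmetric] N_def[symmetric]
    by (simp only: right_diff_distrib distrib_left mult_ac)
qed

definition real_quadratic :: "real \<Rightarrow> real \<Rightarrow> real \<Rightarrow> complex \<Rightarrow> complex" where
  "real_quadratic a b c z = of_real c * z\<^sup>2 + of_real b * z + of_real a"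

text \<open>
  Two complex values at two points impose four real conditions, one too many for the three coefficients.
  The first-order relation holds for every real quadratic polynomial and makes up for the missing coefficient.
\<close>

lemma real_quadratic_interpolation:
  assumes m: "0 < Im m1" "0 < Im m2" "m1 \<noteq> m2"
    and first_order: "(cmod (m1 - m2))\<^sup>2 * (Im m1 * Im Q2 + Im m2 * Im Q1)
      = 2 * (Im m1 * Im m2) * Re (cnj (m1 - m2) * (Q1 - Q2))"
  obtains a b c where "Q1 = real_quadratic a b c m1" "Q2 = real_quadratic a b c m2"
proof -
  define d where "d = (Q1 - Q2) / (m1 - m2)"
  have d: "Q1 - Q2 = (m1 - m2) * d"
    using m by (simp add: d_def)
  \<comment> \<open>The divided difference of a real quadratic is $c(m_1+m_2) + b$, whose imaginary part determines $c$.\<close>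
  define c where "c = Im d / (Im m1 + Im m2)"
  define b where "b = Re d - c * (Re m1 + Re m2)"
  define a where "a = Re Q1 - Re (of_real c * m1\<^sup>2 + of_real b * m1)"
  define R where "R = Re (cnj (m1 - m2) * (Q1 - Q2))"
  have s: "Im m1 + Im m2 \<noteq> 0"
    using m by linarith
  have dd: "d = of_real c * (m1 + m2) + of_real b"
    using s by (simp add: complex_eq_iff c_def b_def)
  have "cnj (m1 - m2) * (Q1 - Q2) = of_real ((cmod (m1 - m2))\<^sup>2) * d"
    unfolding d complex_norm_square by (simp add: algebra_simps)
  then have "R = (cmod (m1 - m2))\<^sup>2 * Re d"
    unfolding R_def by simp
  then have "(cmod (m1 - m2))\<^sup>2 * (Im m1 * Im Q2 + Im m2 * Im Q1)
      = (cmod (m1 - m2))\<^sup>2 * (2 * (Im m1 * Im m2) * Re d)"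
    using first_order[folded R_def] by (simp only: mult_ac)
  then have L: "Im m1 * Im Q2 + Im m2 * Im Q1 = 2 * (Im m1 * Im m2) * Re d"
    using mult_left_cancel[of "(cmod (m1 - m2))\<^sup>2"] m(3) by (metis norm_eq_zero power_not_zero right_minus_eq)
  have "Im Q2 = Im Q1 - Im ((m1 - m2) * d)"
    using d by (metis add_diff_cancel_left' diff_add_cancel minus_complex.sel(2))
  then have "Im Q1 * (Im m1 + Im m2) = (Im m1 * Im Q2 + Im m2 * Im Q1) + Im m1 * Im ((m1 - m2) * d)"
    by (simp only: right_diff_distrib distrib_left mult_ac)
  also have "\<dots> = 2 * (Im m1 * Im m2) * Re d + Im m1 * Im ((m1 - m2) * d)"
    unfolding L ..
  also have "\<dots> = Im m1 * (Re d + c * (Re m1 - Re m2)) * (Im m1 + Im m2)"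
    using s by (simp add: c_def field_simps)
  finally have "Im Q1 = Im m1 * (Re d + c * (Re m1 - Re m2))"
    using s by simp
  also have "\<dots> = Im (real_quadratic a b c m1)"
    by (simp add: real_quadratic_def b_def power2_eq_square algebra_simps)
  finally have 1: "Q1 = real_quadratic a b c m1"
    by (simp add: complex_eq_iff a_def real_quadratic_def)
  have "Q2 = Q1 - (m1 - m2) * (of_real c * (m1 + m2) + of_real b)"
    using d dd by (simp add: algebra_simps)
  also have "\<dots> = real_quadratic a b c m2"
    unfolding 1 by (simp add: real_quadratic_def power2_eq_square algebra_simps)
  finally show ?thesis
    using 1 that by blast
qed

text \<open>
  Along the graph of a real quadratic polynomial $q$ each function is a combination of the identity
  and of $1/(m-x)$ with the real coefficients $1-c$ and $-q(x)$, up to a real constant.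
\<close>

lemma halfplane_magic_real_quadratic:
  assumes "0 < Im m"
  shows "halfplane_magic x m (real_quadratic a b c m) =
     of_real (1 - c) * m - of_real (a + b * x + c * x\<^sup>2) * inverse (m - of_real x) - of_real (c * x + b)"
proof -
  have "m - of_real x \<noteq> 0"
    using assms by (auto simp: complex_eq_iff)
  then show ?thesis
    by (simp add: halfplane_magic_def real_quadratic_def divide_inverse[symmetric] diff_frac_eq) (simp add: field_simps power2_eq_square)
qed

lemma Im_halfplane_magic_real_quadratic:
  assumes "0 < Im m"
  shows "Im (halfplane_magic x m (real_quadratic a b c m)) =
    Im m * ((1 - c) + (a + b * x + c * x\<^sup>2) * (cmod (inverse (m - of_real x)))\<^sup>2)"
proof -
  have "Im (inverse (m - of_real x)) = - Im m * (cmod (inverse (m - of_real x)))\<^sup>2"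
    by (simp add: norm_inverse power_inverse cmod_power2 divide_inverse)
  then show ?thesis
    unfolding halfplane_magic_real_quadratic[OF assms] by (simp add: algebra_simps)
qed

lemma halfplane_magic_real_quadratic_diff:
  assumes "0 < Im m1" "0 < Im m2"
  shows "halfplane_magic x m1 (real_quadratic a b c m1) - halfplane_magic x m2 (real_quadratic a b c m2) =
    (m1 - m2) * (of_real (1 - c) + of_real (a + b * x + c * x\<^sup>2) * (inverse (m1 - of_real x) * inverse (m2 - of_real x)))"
proof -
  have "m1 - of_real x \<noteq> 0" "m2 - of_real x \<noteq> 0"
    using assms by (auto simp: complex_eq_iff)
  then have inv: "inverse (m2 - of_real x) - inverse (m1 - of_real x)
     = (m1 - m2) * (inverse (m1 - of_real x) * inverse (m2 - of_real x))"
    by (simp add: field_simps)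
  have "(A * m1 - B * i1 - k) - (A * m2 - B * i2 - k) = (m1 - m2) * A + B * (i2 - i1)" for A B i1 i2 k :: complex
    by (simp add: algebra_simps)
  then show ?thesis
    unfolding halfplane_magic_real_quadratic[OF assms(1)] halfplane_magic_real_quadratic[OF assms(2)]
    by (simp only: inv distrib_left mult.left_commute)
qed

text \<open>
  With $A = 1-c$, $B = q(x)$ and $u_j = 1/(m_j - x)$ the maximality condition reduces to
  $0 \le A B |u_1 - \bar u_2|^2$. So $A$ and $B$ do not have opposite signs, and positivity of the imaginary
  part of the function attached to $x$ shows that they are nonnegative and not both zero.
\<close>

lemma infinity_maximal_real_quadratic:
  assumes m: "0 < Im m1" "0 < Im m2" "m1 \<noteq> m2"
    and Q: "Q1 = real_quadratic a b c m1" "Q2 = real_quadratic a b c m2"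
    and max: "infinity_maximal m1 Q1 m2 Q2"
    and pos: "\<And>x. 0 < Im (halfplane_magic x m1 Q1)"
  shows "0 \<le> a + b * x + c * x\<^sup>2" "c \<le> 1" "c = 1 \<Longrightarrow> 0 < a + b * x + c * x\<^sup>2"
proof -
  define A where "A = 1 - c"
  define B where "B = a + b * x + c * x\<^sup>2"
  define u1 where "u1 = inverse (m1 - of_real x)"
  define u2 where "u2 = inverse (m2 - of_real x)"
  have AB1: "0 < A + B * (cmod u1)\<^sup>2"
    using pos[of x] m unfolding Q Im_halfplane_magic_real_quadratic[OF m(1)] A_def B_def u1_def
    by (simp add: zero_less_mult_iff)
  let ?h1 = "halfplane_magic x m1 Q1" and ?h2 = "halfplane_magic x m2 Q2"
  have "(cmod (?h1 - ?h2))\<^sup>2 * (Im m1 * Im m2) \<le> (cmod (m1 - m2))\<^sup>2 * (Im ?h1 * Im ?h2)"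
    using max by (simp add: infinity_maximal_def)
  then have "((cmod (m1 - m2))\<^sup>2 * (Im m1 * Im m2)) * (cmod (of_real A + of_real B * (u1 * u2)))\<^sup>2
     \<le> ((cmod (m1 - m2))\<^sup>2 * (Im m1 * Im m2)) * ((A + B * (cmod u1)\<^sup>2) * (A + B * (cmod u2)\<^sup>2))"
    unfolding Q Im_halfplane_magic_real_quadratic[OF m(1)] Im_halfplane_magic_real_quadratic[OF m(2)]
      halfplane_magic_real_quadratic_diff[OF m(1,2)] A_def[symmetric] B_def[symmetric] u1_def[symmetric]
      u2_def[symmetric] norm_mult power_mult_distrib by (simp only: mult_ac)
  then have "(cmod (of_real A + of_real B * (u1 * u2)))\<^sup>2 \<le> (A + B * (cmod u1)\<^sup>2) * (A + B * (cmod u2)\<^sup>2)"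
    using m by (simp add: mult_le_cancel_left)
  moreover have "(A + B * (cmod u1)\<^sup>2) * (A + B * (cmod u2)\<^sup>2) - (cmod (of_real A + of_real B * (u1 * u2)))\<^sup>2
      = A * B * (cmod (u1 - cnj u2))\<^sup>2"
    unfolding cmod_power2 by (simp add: power2_eq_square algebra_simps)
  ultimately have "0 \<le> A * B * (cmod (u1 - cnj u2))\<^sup>2"
    by linarith
  moreover have "u1 - cnj u2 \<noteq> 0"
  proof -
    have "Im u1 < 0" "Im u2 < 0"
      using m by (auto simp: u1_def u2_def divide_neg_pos add_nonneg_pos)
    then show ?thesis
      by (auto simp: complex_eq_iff)
  qed
  ultimately have AB: "0 \<le> A * B"
    by (simp add: zero_le_mult_iff)
  have "0 \<le> A \<and> 0 \<le> B \<and> (A = 0 \<longrightarrow> 0 < B)"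
  proof -
    have "\<not> (A \<le> 0 \<and> B \<le> 0)"
      using AB1 mult_nonpos_nonneg[of B "(cmod u1)\<^sup>2"] by auto
    then show ?thesis
      using AB by (auto simp: zero_le_mult_iff)
  qed
  then show "0 \<le> a + b * x + c * x\<^sup>2" "c \<le> 1" "c = 1 \<Longrightarrow> 0 < a + b * x + c * x\<^sup>2"
    by (auto simp: A_def B_def)
qed

lemma nonneg_quadratic_discriminant:
  fixes B D c :: real
  assumes "\<And>t. 0 \<le> B + D * t + c * t\<^sup>2"
  shows "D\<^sup>2 \<le> 4 * c * B" "0 \<le> c"
proof -
  have B: "0 \<le> B"
    using assms[of 0] by simp
  show c: "0 \<le> c"
  proof (rule ccontr)
    assume c: "\<not> 0 \<le> c"
    define t where "t = 1 + B / (- c)"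
    have "t \<ge> 1"
      using c B by (simp add: t_def divide_nonneg_neg)
    then have "c * t\<^sup>2 \<le> c * t"
      using c by (simp add: power2_eq_square)
    also have "c * t = c - B"
      using c by (simp add: t_def algebra_simps)
    finally have "B + c * t\<^sup>2 < 0"
      using c by simp
    then show False
      using assms[of t] assms[of "- t"] by simp
  qed
  show "D\<^sup>2 \<le> 4 * c * B"
  proof (cases "c = 0")
    case True
    have "D = 0"
    proof (rule ccontr)
      assume "D \<noteq> 0"
      then show False
        using assms[of "- (B + 1) / D"] True by simp
    qed
    then show ?thesis
      using True by simp
  next
    case False
    have "D * (- D / (2 * c)) + c * (- D / (2 * c))\<^sup>2 = - (D\<^sup>2 / (4 * c))"
      using False by (simp add: power2_eq_square field_simps)
    then have "D\<^sup>2 / (4 * c) \<le> B"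
      using assms[of "- D / (2 * c)"] by simp
    then show ?thesis
      using False c by (simp add: field_simps)
  qed
qed

text \<open>
  At $\tau = x + iy$ the real part of $q$ is $B - c y^2$ with $B = q(x)$, and the discriminant inequality for $q$
  bounds $|q(\tau)|$ by $B + c y^2$. This leaves $2 c y^2$ for the difference. If $c = 1$, strictness
  comes from the discriminant, which is then negative.
\<close>

lemma real_quadratic_inside:
  assumes nonneg: "\<And>x. 0 \<le> a + b * x + c * x\<^sup>2" and c: "c \<le> 1"
    and pos: "\<And>x. c = 1 \<Longrightarrow> 0 < a + b * x + c * x\<^sup>2" and \<tau>: "0 < Im \<tau>"
  shows "cmod (real_quadratic a b c \<tau>) - Re (real_quadratic a b c \<tau>) < 2 * (Im \<tau>)\<^sup>2"
proof -
  define x where "x = Re \<tau>"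
  define y where "y = Im \<tau>"
  define B where "B = a + b * x + c * x\<^sup>2"
  define D where "D = 2 * c * x + b"
  have shift: "B + D * t + c * t\<^sup>2 = a + b * (x + t) + c * (x + t)\<^sup>2" for t
    by (simp add: B_def D_def power2_eq_square algebra_simps)
  have disc: "D\<^sup>2 \<le> 4 * c * B" and c0: "0 \<le> c"
    using nonneg_quadratic_discriminant[of B D c] nonneg shift by auto
  have B0: "0 \<le> B"
    using nonneg by (simp add: B_def)
  have Q: "real_quadratic a b c \<tau> = Complex (B - c * y\<^sup>2) (y * D)"
    by (simp add: real_quadratic_def complex_eq_iff B_def D_def x_def y_def power2_eq_square algebra_simps)
  have Bc: "0 \<le> B + c * y\<^sup>2"
    using B0 c0 by simp
  have y: "0 < y"
    using \<tau> by (simp add: y_def)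
  have sq: "(cmod (real_quadratic a b c \<tau>))\<^sup>2 = (B + c * y\<^sup>2)\<^sup>2 - y\<^sup>2 * (4 * c * B - D\<^sup>2)"
    unfolding Q cmod_power2 by (simp add: power2_eq_square algebra_simps)
  have "cmod (real_quadratic a b c \<tau>) < B - c * y\<^sup>2 + 2 * y\<^sup>2"
  proof (cases "c = 1")
    case True
    have "0 < B + D * (- D / 2) + c * (- D / 2)\<^sup>2"
      unfolding shift using pos True by blast
    then have "D\<^sup>2 < 4 * c * B"
      using True by (simp add: power2_eq_square)
    then have "0 < y\<^sup>2 * (4 * c * B - D\<^sup>2)"
      using y by simp
    then have "(cmod (real_quadratic a b c \<tau>))\<^sup>2 < (B + c * y\<^sup>2)\<^sup>2"
      using sq by linarith
    then have "cmod (real_quadratic a b c \<tau>) < B + c * y\<^sup>2"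
      using Bc by (rule power2_less_imp_less)
    moreover have "c * y\<^sup>2 = y\<^sup>2"
      using True by simp
    ultimately show ?thesis
      by linarith
  next
    case False
    have "0 \<le> y\<^sup>2 * (4 * c * B - D\<^sup>2)"
      using disc by (intro mult_nonneg_nonneg zero_le_power2) linarith
    then have "(cmod (real_quadratic a b c \<tau>))\<^sup>2 \<le> (B + c * y\<^sup>2)\<^sup>2"
      using sq by linarith
    then have "cmod (real_quadratic a b c \<tau>) \<le> B + c * y\<^sup>2"
      using Bc by (rule power2_le_imp_le)
    moreover have "c * y\<^sup>2 < 1 * y\<^sup>2"
      using y c False by (intro mult_strict_right_mono) auto
    ultimately show ?thesis
      by linarith
  qed
  then show ?thesis
    by (simp add: Q y_def)
qed

section \<open>The Caratheodory distance of the symmetrized bidisc\<close>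

lemma caratheodory_dist_pseudo_dist:
  "caratheodory_dist S p q =
     (SUP f \<in> {f. holomorphic_on_C2 f S \<and> f ` S \<subseteq> unit_disc}. ereal (artanh (pseudo_dist (f p) (f q))))"
  by (simp add: caratheodory_dist_def pseudo_dist_def)

lemma unit_circle_real_parameter:
  assumes "cmod \<omega> = 1" "\<omega> \<noteq> 1"
  obtains x :: real where "\<omega> = (of_real x + \<i>) / (of_real x - \<i>)"
proof -
  have sq: "(Re \<omega>)\<^sup>2 + (Im \<omega>)\<^sup>2 = 1"
    using assms(1) by (metis cmod_power2 one_power2)
  have "Re \<omega> \<noteq> 1"
    using sq assms(2) by (auto simp: complex_eq_iff)
  define x where "x = Im \<omega> / (1 - Re \<omega>)"
  have x: "x * (1 - Re \<omega>) = Im \<omega>"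
    using \<open>Re \<omega> \<noteq> 1\<close> by (simp add: x_def)
  have "(1 - Re \<omega>) * (x * Im \<omega>) = (x * (1 - Re \<omega>)) * Im \<omega>"
    by (simp only: mult_ac)
  also have "\<dots> = (1 - Re \<omega>) * (1 + Re \<omega>)"
    unfolding x using sq by (simp add: power2_eq_square algebra_simps)
  finally have y: "x * Im \<omega> = 1 + Re \<omega>"
    using \<open>Re \<omega> \<noteq> 1\<close> by simp
  have "\<omega> * (of_real x - \<i>) = of_real x + \<i>"
    using x y by (simp add: complex_eq_iff algebra_simps)
  moreover have "of_real x - \<i> \<noteq> 0"
    by (simp add: complex_eq_iff)
  ultimately show ?thesis
    using that[of x] by (simp add: eq_divide_eq)
qed

lemma infinity_maximal_chart:
  assumes l: "0 < Im m1" "chart_denom m1 Q1 \<noteq> 0" "chart m1 Q1 \<in> symm_bidisc"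
    and \<mu>: "0 < Im m2" "chart_denom m2 Q2 \<noteq> 0" "chart m2 Q2 \<in> symm_bidisc"
    and max: "\<And>\<omega>. cmod \<omega> = 1 \<Longrightarrow> pseudo_dist (magic \<omega> (chart m1 Q1)) (magic \<omega> (chart m2 Q2))
      \<le> pseudo_dist (magic 1 (chart m1 Q1)) (magic 1 (chart m2 Q2))"
  shows "infinity_maximal m1 Q1 m2 Q2"
  unfolding infinity_maximal_def
proof
  fix x
  have "pseudo_dist (- cayley (halfplane_magic x m1 Q1)) (- cayley (halfplane_magic x m2 Q2))
      \<le> pseudo_dist (- cayley m1) (- cayley m2)"
    using max[OF cmod_real_plus_ii_quotient[of x]] l \<mu> by (simp add: magic_chart(1)[where x=x] magic_1_chart)
  then show "(cmod (halfplane_magic x m1 Q1 - halfplane_magic x m2 Q2))\<^sup>2 * (Im m1 * Im m2)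
      \<le> (cmod (m1 - m2))\<^sup>2 * (Im (halfplane_magic x m1 Q1) * Im (halfplane_magic x m2 Q2))"
    using pseudo_dist_cayley_le_iff halfplane_magic_pos l \<mu> by blast
qed

lemma infinity_maximal_same_mean:
  assumes "infinity_maximal m Q1 m Q2" "0 < Im m"
  shows "Q1 = Q2"
proof -
  have "halfplane_magic 0 m Q1 = halfplane_magic 0 m Q2"
    using assms unfolding infinity_maximal_def by (auto dest!: spec[of _ 0] simp: mult_le_0_iff)
  moreover have "m \<noteq> 0"
    using assms by auto
  ultimately show ?thesis
    by (simp add: halfplane_magic_def)
qed

text \<open>
  The interpolating real quadratic polynomial gives a disc in $G$ through both points on which $\Phi_1$ is an
  isometry, since $\Phi_1$ is the coordinate $m$ of that disc up to a Cayley transform and a sign.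
\<close>

lemma extremal_disc:
  assumes "p \<in> symm_bidisc" "\<mu> \<in> symm_bidisc" "p \<noteq> \<mu>"
    and max: "\<And>\<omega>. cmod \<omega> = 1 \<Longrightarrow> pseudo_dist (magic \<omega> p) (magic \<omega> \<mu>) \<le> pseudo_dist (magic 1 p) (magic 1 \<mu>)"
  obtains k u v where "(\<lambda>z. fst (k z)) holomorphic_on unit_disc" "(\<lambda>z. snd (k z)) holomorphic_on unit_disc"
    "k ` unit_disc \<subseteq> symm_bidisc" "u \<in> unit_disc" "v \<in> unit_disc" "k u = p" "k v = \<mu>"
    "pseudo_dist u v = pseudo_dist (magic 1 p) (magic 1 \<mu>)"
proof -
  obtain m1 Q1 where 1: "0 < Im m1" "chart_denom m1 Q1 \<noteq> 0" "p = chart m1 Q1"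
    using symm_bidisc_chart assms(1) by blast
  obtain m2 Q2 where 2: "0 < Im m2" "chart_denom m2 Q2 \<noteq> 0" "\<mu> = chart m2 Q2"
    using symm_bidisc_chart assms(2) by blast
  have inf: "infinity_maximal m1 Q1 m2 Q2"
    using infinity_maximal_chart 1 2 assms by metis
  have ne: "m1 \<noteq> m2"
    using infinity_maximal_same_mean inf 1 2 assms(3) by blast
  obtain a b c where Q: "Q1 = real_quadratic a b c m1" "Q2 = real_quadratic a b c m2"
    using real_quadratic_interpolation infinity_maximal_first_order inf 1 2 ne by metis
  note nonneg = infinity_maximal_real_quadratic[OF 1(1) 2(1) ne Q inf]
  have pos: "0 < Im (halfplane_magic x m1 Q1)" for x
    using halfplane_magic_pos 1 assms(1) by blast
  define T where "T z = \<i> * (1 + z) / (1 - z)" for z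
  define k where "k z = chart (T z) (real_quadratic a b c (T z))" for z
  have T: "0 < Im (T z)" "cayley (T z) = z" if "cmod z < 1" for z
  proof -
    have z: "1 - z \<noteq> 0"
      using that by auto
    then have "T z + \<i> = 2 * \<i> / (1 - z)" "T z - \<i> = 2 * \<i> * z / (1 - z)"
      by (auto simp: T_def field_simps)
    then show "cayley (T z) = z" "0 < Im (T z)"
      using z cmod_cayley_less_1_iff[of "T z"] that by (auto simp: cayley_def)
  qed
  have Tc: "T (cayley w) = w" if "0 < Im w" for w
  proof -
    have "w + \<i> \<noteq> 0"
      using that plus_ii_nonzero by blast
    then have "1 + cayley w = 2 * w / (w + \<i>)" "1 - cayley w = 2 * \<i> / (w + \<i>)"
      by (auto simp: cayley_def field_simps)
    then show ?thesis
      using \<open>w + \<i> \<noteq> 0\<close> by (simp add: T_def)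
  qed
  have kin: "k z \<in> symm_bidisc \<and> chart_denom (T z) (real_quadratic a b c (T z)) \<noteq> 0" if "cmod z < 1" for z
    unfolding k_def using chart_in_symm_bidisc[OF T(1)[OF that]] real_quadratic_inside nonneg pos T(1)[OF that]
    by blast
  have holT: "T holomorphic_on unit_disc"
    unfolding T_def by (intro holomorphic_intros) auto
  have c1: "cmod (cayley m1) < 1" and c2: "cmod (cayley m2) < 1"
    using 1 2 cmod_cayley_less_1_iff plus_ii_nonzero by auto
  show ?thesis
  proof (rule that[of k "cayley m1" "cayley m2"])
    show "(\<lambda>z. fst (k z)) holomorphic_on unit_disc" "(\<lambda>z. snd (k z)) holomorphic_on unit_disc"
      unfolding k_def chart_def fst_conv snd_conv using kin
      by (auto simp: chart_denom_def real_quadratic_def intro!: holomorphic_intros holT)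
    show "k ` unit_disc \<subseteq> symm_bidisc"
      using kin by auto
    show "k (cayley m1) = p" "k (cayley m2) = \<mu>"
      using Tc 1 2 Q by (auto simp: k_def)
    show "pseudo_dist (cayley m1) (cayley m2) = pseudo_dist (magic 1 p) (magic 1 \<mu>)"
      using pseudo_dist_rotate[of "-1" "cayley m1" "cayley m2"] 1 2 by (simp add: magic_1_chart)
  qed (use c1 c2 in auto)
qed

text \<open>
  The automorphism of $G$ induced by the rotation of both roots by $\eta$. It permutes the magic functions
  up to unimodular factors, which reduces an arbitrary extremal $\omega$ to $\omega = 1$.
\<close>

definition bidisc_rotation :: "complex \<Rightarrow> complex \<times> complex \<Rightarrow> complex \<times> complex" where
  "bidisc_rotation \<eta> q = (\<eta> * fst q, \<eta>\<^sup>2 * snd q)"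

lemma bidisc_rotation_in_symm_bidisc:
  assumes "cmod \<eta> = 1" "q \<in> symm_bidisc"
  shows "bidisc_rotation \<eta> q \<in> symm_bidisc"
proof -
  obtain z w where "q = (z + w, z * w)" "cmod z < 1" "cmod w < 1"
    using assms(2) by (auto simp: symm_bidisc_def)
  then have "bidisc_rotation \<eta> q = (\<eta> * z + \<eta> * w, (\<eta> * z) * (\<eta> * w))"
    "cmod (\<eta> * z) < 1" "cmod (\<eta> * w) < 1"
    using assms(1) by (auto simp: bidisc_rotation_def norm_mult power2_eq_square algebra_simps)
  then show ?thesis
    unfolding symm_bidisc_def by auto
qed

lemma bidisc_rotation_inverse:
  assumes "cmod \<eta> = 1" shows "bidisc_rotation (cnj \<eta>) (bidisc_rotation \<eta> q) = q"
proof -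
  have "cnj \<eta> * \<eta> = 1"
    using assms by (metis complex_norm_square mult.commute of_real_1 one_power2)
  then have *: "cnj \<eta> * (\<eta> * z) = z" "(cnj \<eta>)\<^sup>2 * (\<eta>\<^sup>2 * z) = z" for z
    by (simp_all add: mult.assoc[symmetric] power_mult_distrib[symmetric])
  show ?thesis
    unfolding bidisc_rotation_def fst_conv snd_conv * by simp
qed

lemma magic_bidisc_rotation: "magic \<omega> (bidisc_rotation \<eta> q) = \<eta> * magic (\<omega> * \<eta>) q"
  by (simp add: magic_def bidisc_rotation_def power2_eq_square algebra_simps)

lemma pseudo_dist_magic_rotation:
  "cmod \<eta> = 1 \<Longrightarrow> pseudo_dist (magic \<omega> (bidisc_rotation \<eta> p)) (magic \<omega> (bidisc_rotation \<eta> q))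
    = pseudo_dist (magic (\<omega> * \<eta>) p) (magic (\<omega> * \<eta>) q)"
  by (simp add: magic_bidisc_rotation pseudo_dist_rotate)

lemma artanh_pseudo_dist_mono:
  assumes "cmod a < 1" "cmod b < 1" "cmod a' < 1" "cmod b' < 1" "pseudo_dist a b \<le> pseudo_dist a' b'"
  shows "artanh (pseudo_dist a b) \<le> artanh (pseudo_dist a' b')"
  using assms by (simp add: artanh_le_iff pseudo_dist_nonneg pseudo_dist_less_1)

text \<open>
  By compactness of the circle some $\omega$ separates the two points best among the magic functions. Restricting
  an arbitrary competitor to the extremal disc, rotated back, and applying the Schwarz-Pick lemma shows
  that it does no better.
\<close>

theorem caratheodory_dist_symm_bidisc:
  assumes p: "p \<in> symm_bidisc" and \<mu>: "\<mu> \<in> symm_bidisc"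
  obtains \<omega> where "cmod \<omega> = 1"
    "\<And>\<omega>'. cmod \<omega>' = 1 \<Longrightarrow> pseudo_dist (magic \<omega>' p) (magic \<omega>' \<mu>) \<le> pseudo_dist (magic \<omega> p) (magic \<omega> \<mu>)"
    "caratheodory_dist symm_bidisc p \<mu> = ereal (artanh (pseudo_dist (magic \<omega> p) (magic \<omega> \<mu>)))"
proof -
  have cont: "continuous_on (sphere 0 1) (\<lambda>\<omega>. magic \<omega> q)" if "q \<in> symm_bidisc" for q
    unfolding magic_def using magic_denominator_nonzero[OF that]
    by (intro continuous_intros) auto
  have "continuous_on (sphere 0 1) (\<lambda>\<omega>. pseudo_dist (magic \<omega> p) (magic \<omega> \<mu>))"
    unfolding pseudo_dist_def
    by (intro continuous_intros cont ballI one_minus_cnj_mult_nonzero magic_in_disc p \<mu>) (simp_all only: mem_sphere_0)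
  then obtain \<omega> where \<omega>: "cmod \<omega> = 1" and max: "\<And>\<omega>'. cmod \<omega>' = 1 \<Longrightarrow>
      pseudo_dist (magic \<omega>' p) (magic \<omega>' \<mu>) \<le> pseudo_dist (magic \<omega> p) (magic \<omega> \<mu>)"
    using continuous_attains_sup[of "sphere (0::complex) 1"] by force
  have upper: "pseudo_dist (f p) (f \<mu>) \<le> pseudo_dist (magic \<omega> p) (magic \<omega> \<mu>)"
    if f: "holomorphic_on_C2 f symm_bidisc" "f ` symm_bidisc \<subseteq> unit_disc" for f
  proof (cases "p = \<mu>")
    case True
    then show ?thesis
      by (simp add: pseudo_dist_def)
  next
    case False
    let ?r = "bidisc_rotation \<omega>"
    have "?r p \<noteq> ?r \<mu>"
      using False bidisc_rotation_inverse[OF \<omega>] by metis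
    moreover have "pseudo_dist (magic \<omega>' (?r p)) (magic \<omega>' (?r \<mu>)) \<le> pseudo_dist (magic 1 (?r p)) (magic 1 (?r \<mu>))"
      if "cmod \<omega>' = 1" for \<omega>'
      using max[of "\<omega>' * \<omega>"] \<omega> that by (simp add: pseudo_dist_magic_rotation norm_mult)
    ultimately obtain k u v where k: "(\<lambda>z. fst (k z)) holomorphic_on unit_disc" "(\<lambda>z. snd (k z)) holomorphic_on unit_disc"
      "k ` unit_disc \<subseteq> symm_bidisc" "u \<in> unit_disc" "v \<in> unit_disc" "k u = ?r p" "k v = ?r \<mu>"
      "pseudo_dist u v = pseudo_dist (magic 1 (?r p)) (magic 1 (?r \<mu>))"
      using extremal_disc[of "?r p" "?r \<mu>"] p \<mu> \<omega> bidisc_rotation_in_symm_bidisc by metis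
    define k' where "k' z = bidisc_rotation (cnj \<omega>) (k z)" for z
    have k': "(\<lambda>z. fst (k' z)) holomorphic_on unit_disc" "(\<lambda>z. snd (k' z)) holomorphic_on unit_disc"
      unfolding k'_def bidisc_rotation_def fst_conv snd_conv by (intro holomorphic_intros k)+
    have k'_in: "k' ` unit_disc \<subseteq> symm_bidisc"
      unfolding k'_def using k(3) \<omega> by (intro image_subsetI bidisc_rotation_in_symm_bidisc) auto
    have "(\<lambda>z. f (k' z)) holomorphic_on unit_disc"
      using holomorphic_on_C2_compose[OF f(1) k' k'_in] .
    moreover have "(\<lambda>z. f (k' z)) ` unit_disc \<subseteq> unit_disc"
      using k'_in f(2) by blast
    ultimately have "pseudo_dist (f (k' u)) (f (k' v)) \<le> pseudo_dist u v"
      using k(4,5) by (rule Schwarz_Pick_le)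
    then show ?thesis
      using k(6,7,8) \<omega> by (simp add: k'_def bidisc_rotation_inverse pseudo_dist_magic_rotation)
  qed
  have mag: "holomorphic_on_C2 (magic \<omega>) symm_bidisc \<and> magic \<omega> ` symm_bidisc \<subseteq> unit_disc"
    using magic_holomorphic_on_C2[OF \<omega>] magic_in_disc \<omega> by auto
  have "caratheodory_dist symm_bidisc p \<mu> = ereal (artanh (pseudo_dist (magic \<omega> p) (magic \<omega> \<mu>)))"
    unfolding caratheodory_dist_pseudo_dist
  proof (rule antisym)
    show "(SUP f \<in> {f. holomorphic_on_C2 f symm_bidisc \<and> f ` symm_bidisc \<subseteq> unit_disc}.
        ereal (artanh (pseudo_dist (f p) (f \<mu>)))) \<le> ereal (artanh (pseudo_dist (magic \<omega> p) (magic \<omega> \<mu>)))"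
    proof (rule SUP_least)
      fix f assume "f \<in> {f. holomorphic_on_C2 f symm_bidisc \<and> f ` symm_bidisc \<subseteq> unit_disc}"
      then have f: "holomorphic_on_C2 f symm_bidisc" "f ` symm_bidisc \<subseteq> unit_disc"
        by auto
      then have "cmod (f p) < 1" "cmod (f \<mu>) < 1"
        using p \<mu> by (auto simp: image_subset_iff)
      then show "ereal (artanh (pseudo_dist (f p) (f \<mu>))) \<le> ereal (artanh (pseudo_dist (magic \<omega> p) (magic \<omega> \<mu>)))"
        using upper[OF f] magic_in_disc p \<mu> \<omega> by (simp add: artanh_pseudo_dist_mono)
    qed
    show "ereal (artanh (pseudo_dist (magic \<omega> p) (magic \<omega> \<mu>)))
      \<le> (SUP f \<in> {f. holomorphic_on_C2 f symm_bidisc \<and> f ` symm_bidisc \<subseteq> unit_disc}.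
        ereal (artanh (pseudo_dist (f p) (f \<mu>))))"
      using mag by (intro SUP_upper[where f = "\<lambda>f. ereal (artanh (pseudo_dist (f p) (f \<mu>)))"]) (simp only: mem_Collect_eq)
  qed
  with \<omega> max show ?thesis
    by (rule that)
qed

section \<open>Flat geodesics\<close>

lemma real_quadratic_first_order:
  "(cmod (m1 - m2))\<^sup>2 * (Im m1 * Im (real_quadratic a b c m2) + Im m2 * Im (real_quadratic a b c m1))
    = 2 * (Im m1 * Im m2) * Re (cnj (m1 - m2) * (real_quadratic a b c m1 - real_quadratic a b c m2))"
  unfolding cmod_power2 real_quadratic_def by (simp add: power2_eq_square algebra_simps)

text \<open>
  Interpolate at $m = i$ and $m = 2i$, and let $g$ be the difference between $Q$ and the interpolating real
  quadratic polynomial. The first-order relation is linear and holds for this polynomial, so $g$ satisfies it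
  against every point where $g$ vanishes. Against $i$ and $2i$ it yields two real equations for $g(m)$, which
  force $g(m) = 0$ unless $m$ lies on the imaginary axis; there a third point, $1 + i$, is used.
\<close>

lemma pairwise_infinity_maximal_real_quadratic:
  assumes pos: "\<And>z. z \<in> A \<Longrightarrow> 0 < Im (m z)"
    and surj: "\<And>\<tau>. 0 < Im \<tau> \<Longrightarrow> \<exists>z\<in>A. m z = \<tau>"
    and max: "\<And>z w. z \<in> A \<Longrightarrow> w \<in> A \<Longrightarrow> infinity_maximal (m z) (Q z) (m w) (Q w)"
  obtains a b c where "\<And>z. z \<in> A \<Longrightarrow> Q z = real_quadratic a b c (m z)"
proof -
  obtain z1 where z1: "z1 \<in> A" "m z1 = \<i>"
    using surj[of \<i>] by auto
  obtain z2 where z2: "z2 \<in> A" "m z2 = 2 * \<i>"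
    using surj[of "2 * \<i>"] by auto
  have "m z1 \<noteq> m z2"
    using z1 z2 by simp
  then obtain a b c where q: "Q z1 = real_quadratic a b c (m z1)" "Q z2 = real_quadratic a b c (m z2)"
    using real_quadratic_interpolation[OF pos[OF z1(1)] pos[OF z2(1)]]
      infinity_maximal_first_order[OF pos[OF z1(1)] pos[OF z2(1)] max[OF z1(1) z2(1)]] by blast
  define g where "g z = Q z - real_quadratic a b c (m z)" for z
  have first_order: "(cmod (m z - m w))\<^sup>2 * (Im (m w) * Im (g z)) = 2 * (Im (m z) * Im (m w)) * Re (cnj (m z - m w) * g z)"
    if "z \<in> A" "w \<in> A" "g w = 0" for z w
  proof -
    have Qw: "Q w = real_quadratic a b c (m w)" and Qz: "Q z = g z + real_quadratic a b c (m z)"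
      using that by (simp_all add: g_def)
    have "(cmod (m z - m w))\<^sup>2 * (Im (m z) * Im (Q w) + Im (m w) * Im (Q z))
        = 2 * (Im (m z) * Im (m w)) * Re (cnj (m z - m w) * (Q z - Q w))"
      using infinity_maximal_first_order pos max that by blast
    moreover have "cnj (m z - m w) * (Q z - Q w) = cnj (m z - m w) * g z
        + cnj (m z - m w) * (real_quadratic a b c (m z) - real_quadratic a b c (m w))"
      unfolding Qw Qz by (simp add: algebra_simps)
    then have "Re (cnj (m z - m w) * (Q z - Q w)) = Re (cnj (m z - m w) * g z)
        + Re (cnj (m z - m w) * (real_quadratic a b c (m z) - real_quadratic a b c (m w)))"
      by (metis plus_complex.sel(1))
    moreover have "Im (Q z) = Im (g z) + Im (real_quadratic a b c (m z))"
      by (simp add: Qz)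
    ultimately show ?thesis
      using real_quadratic_first_order[of "m z" "m w" a b c] unfolding Qw
      by (simp only: distrib_left)
  qed
  have expand: "v * (x\<^sup>2 - y\<^sup>2 + t\<^sup>2) = 2 * y * (x * u)"
    if "z \<in> A" "w \<in> A" "g w = 0" "m z = Complex x y" "g z = Complex u v" "m w = Complex 0 t" for z w x y u v t
  proof -
    have "t > 0"
      using pos[OF that(2)] that(6) by simp
    have "(x\<^sup>2 + (y - t)\<^sup>2) * (t * v) = 2 * (y * t) * (x * u - (t - y) * v)"
      using first_order[OF that(1,2,3)] unfolding that(4,5,6) by (simp add: cmod_power2)
    then have "t * (v * (x\<^sup>2 - y\<^sup>2 + t\<^sup>2)) = t * (2 * y * (x * u))"
      by (simp add: power2_eq_square algebra_simps)
    then show ?thesis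
      using \<open>t > 0\<close> by simp
  qed
  have g1: "g z1 = 0" and g2: "g z2 = 0"
    using q by (auto simp: g_def)
  have off_axis: "Im (g z) = 0 \<and> (Re (m z) \<noteq> 0 \<longrightarrow> g z = 0)" if z: "z \<in> A" for z
  proof -
    define x y u v where xyuv: "x = Re (m z)" "y = Im (m z)" "u = Re (g z)" "v = Im (g z)"
    have *: "m z = Complex x y" "g z = Complex u v"
      by (auto simp: xyuv)
    have "v * (x\<^sup>2 - y\<^sup>2 + 1\<^sup>2) = 2 * y * (x * u)" "v * (x\<^sup>2 - y\<^sup>2 + 2\<^sup>2) = 2 * y * (x * u)"
      using expand[OF z z1(1) g1 *] expand[OF z z2(1) g2 *] z1 z2 by (auto simp: complex_eq_iff)
    then have v: "v = 0"
      by (simp add: algebra_simps)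
    have "y > 0"
      using pos[OF z] by (simp add: xyuv)
    then have "x = 0 \<or> u = 0"
      using expand[OF z z1(1) g1 *, of 1] z1 v by (auto simp: complex_eq_iff)
    then show ?thesis
      using v by (auto simp: * complex_eq_iff)
  qed
  obtain z3 where z3: "z3 \<in> A" "m z3 = 1 + \<i>"
    using surj[of "1 + \<i>"] by auto
  have g3: "g z3 = 0"
    using off_axis[OF z3(1)] z3(2) by simp
  have "g z = 0" if z: "z \<in> A" for z
  proof (cases "Re (m z) = 0")
    case True
    have "Im (g z) = 0"
      using off_axis[OF z] by simp
    then have "2 * (Im (m z) * Im (m z3)) * (- Re (g z)) = 0"
      using first_order[OF z z3(1) g3] True z3(2) by simp
    then have "Re (g z) = 0"
      using pos[OF z] z3(2) by simp
    then show ?thesis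
      using \<open>Im (g z) = 0\<close> by (simp add: complex_eq_iff)
  qed (use off_axis[OF z] in simp)
  then show ?thesis
    using that[of a b c] by (simp add: g_def)
qed

text \<open>
  Along $m = i n$ both coordinates of the chart become quotients of quadratic polynomials in $t = 1/m$ whose
  constant terms are $2(1-c)$ over $1-c$ and $1-c$ over $1-c$.
\<close>

lemma chart_real_quadratic_at_infinity:
  assumes "c \<noteq> 1"
  shows "(\<lambda>n. chart (of_nat (Suc n) * \<i>) (real_quadratic a b c (of_nat (Suc n) * \<i>))) \<longlonglongrightarrow> (2, 1)"
proof -
  define t where "t n = inverse (of_nat (Suc n) * \<i>)" for n
  have t: "t \<longlonglongrightarrow> 0"
  proof -
    have "(\<lambda>n. inverse (complex_of_real (real (Suc n))) * inverse \<i>) \<longlonglongrightarrow> 0 * inverse \<i>"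
      using tendsto_of_real[OF LIMSEQ_inverse_real_of_nat, where 'a=complex]
      by (intro tendsto_mult tendsto_const) simp
    then show ?thesis
      unfolding t_def[abs_def] by (simp add: inverse_mult_distrib del: of_nat_Suc)
  qed
  define C where "C = 1 - complex_of_real c"
  have C: "C \<noteq> 0"
    using assms by (auto simp: C_def)
  have eq: "chart (of_nat (Suc n) * \<i>) (real_quadratic a b c (of_nat (Suc n) * \<i>))
      = (2 * (C - of_real b * t n + (1 - of_real a) * (t n)\<^sup>2) / (C + (2 * \<i> - of_real b) * t n + (- 1 - of_real a) * (t n)\<^sup>2),
         (C + (- 2 * \<i> - of_real b) * t n + (- 1 - of_real a) * (t n)\<^sup>2) / (C + (2 * \<i> - of_real b) * t n + (- 1 - of_real a) * (t n)\<^sup>2))" for n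
  proof -
    define \<tau> where "\<tau> = of_nat (Suc n) * \<i>"
    have \<tau>: "\<tau> \<noteq> 0" "t n = inverse \<tau>"
      by (auto simp: \<tau>_def t_def simp del: of_nat_Suc)
    have cancel: "x / y = (x * (t n)\<^sup>2) / (y * (t n)\<^sup>2)" for x y
      using \<tau> by simp
    have e: "\<tau> * t n = 1" "\<tau>\<^sup>2 * (t n)\<^sup>2 = 1"
      using \<tau> by (auto simp: power_mult_distrib[symmetric])
    have s: "(C * \<tau>\<^sup>2 + p * \<tau> + q) * (t n)\<^sup>2 = C + p * t n + q * (t n)\<^sup>2" for p q
    proof -
      have "(C * \<tau>\<^sup>2 + p * \<tau> + q) * (t n)\<^sup>2 = C * (\<tau>\<^sup>2 * (t n)\<^sup>2) + p * (\<tau> * t n) * t n + q * (t n)\<^sup>2"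
        by (simp add: power2_eq_square algebra_simps)
      then show ?thesis
        by (simp add: e)
    qed
    have 1: "2 * (\<tau>\<^sup>2 - real_quadratic a b c \<tau> + 1) = 2 * (C * \<tau>\<^sup>2 + (- of_real b) * \<tau> + (1 - of_real a))"
      "chart_denom \<tau> (real_quadratic a b c \<tau>) = C * \<tau>\<^sup>2 + (2 * \<i> - of_real b) * \<tau> + (- 1 - of_real a)"
      "(\<tau> - \<i>)\<^sup>2 - real_quadratic a b c \<tau> = C * \<tau>\<^sup>2 + (- 2 * \<i> - of_real b) * \<tau> + (- 1 - of_real a)"
      by (simp_all add: C_def chart_denom_def real_quadratic_def power2_eq_square algebra_simps)
    show ?thesis
      unfolding \<tau>_def[symmetric] chart_def 1 cancel[of "2 * (C * \<tau>\<^sup>2 + (- of_real b) * \<tau> + (1 - of_real a))"]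
        cancel[of "C * \<tau>\<^sup>2 + (- 2 * \<i> - of_real b) * \<tau> + (- 1 - of_real a)"] mult.assoc[of 2] s
      by simp
  qed
  have "(\<lambda>n. (2 * (C - of_real b * t n + (1 - of_real a) * (t n)\<^sup>2) / (C + (2 * \<i> - of_real b) * t n + (- 1 - of_real a) * (t n)\<^sup>2),
         (C + (- 2 * \<i> - of_real b) * t n + (- 1 - of_real a) * (t n)\<^sup>2) / (C + (2 * \<i> - of_real b) * t n + (- 1 - of_real a) * (t n)\<^sup>2)))
    \<longlonglongrightarrow> (2 * (C - of_real b * 0 + (1 - of_real a) * 0\<^sup>2) / (C + (2 * \<i> - of_real b) * 0 + (- 1 - of_real a) * 0\<^sup>2),
         (C + (- 2 * \<i> - of_real b) * 0 + (- 1 - of_real a) * 0\<^sup>2) / (C + (2 * \<i> - of_real b) * 0 + (- 1 - of_real a) * 0\<^sup>2))"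
    using C by (intro tendsto_intros t) auto
  then show ?thesis
    unfolding eq using C by simp
qed

lemma royal_boundary_in_closure:
  assumes "cmod \<eta> = 1"
  shows "(2 * \<eta>, \<eta>\<^sup>2) \<in> closure royal_variety" "(2 * \<eta>, \<eta>\<^sup>2) \<notin> royal_variety"
proof -
  have R: "royal_variety = (\<lambda>z. (2 * z, z\<^sup>2)) ` unit_disc"
    by (auto simp: royal_variety_def)
  have "(\<lambda>z::complex. (2 * z, z\<^sup>2)) ` closure unit_disc \<subseteq> closure ((\<lambda>z. (2 * z, z\<^sup>2)) ` unit_disc)"
    by (intro image_closure_subset closure_subset closed_closure continuous_intros)
  moreover have "\<eta> \<in> closure unit_disc"
    using assms by simp
  ultimately show "(2 * \<eta>, \<eta>\<^sup>2) \<in> closure royal_variety"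
    unfolding R by blast
  show "(2 * \<eta>, \<eta>\<^sup>2) \<notin> royal_variety"
    using assms by (auto simp: royal_variety_def)
qed

text \<open>
  The left inverse of a geodesic is a competitor for the Caratheodory distance that does not shrink
  distances on the geodesic, so the extremal magic function for two points of it does not either.
\<close>

lemma geodesic_extremal_magic:
  assumes h: "(\<lambda>z. fst (h z)) holomorphic_on unit_disc" "(\<lambda>z. snd (h z)) holomorphic_on unit_disc"
      "h ` unit_disc \<subseteq> symm_bidisc"
    and \<Phi>: "holomorphic_on_C2 \<Phi> symm_bidisc" "\<Phi> ` symm_bidisc \<subseteq> unit_disc" "\<And>z. z \<in> unit_disc \<Longrightarrow> \<Phi> (h z) = z"
  obtains \<omega> where "cmod \<omega> = 1"
    "pseudo_dist (magic \<omega> (h 0)) (magic \<omega> (h (1 / 2))) = pseudo_dist 0 (1 / 2)"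
proof -
  have in_G: "h 0 \<in> symm_bidisc" "h (1 / 2) \<in> symm_bidisc"
    using h(3) by auto
  obtain \<omega> where \<omega>: "cmod \<omega> = 1"
    and d: "caratheodory_dist symm_bidisc (h 0) (h (1 / 2))
      = ereal (artanh (pseudo_dist (magic \<omega> (h 0)) (magic \<omega> (h (1 / 2)))))"
    using caratheodory_dist_symm_bidisc[OF in_G] by metis
  have "ereal (artanh (pseudo_dist (\<Phi> (h 0)) (\<Phi> (h (1 / 2))))) \<le> caratheodory_dist symm_bidisc (h 0) (h (1 / 2))"
    unfolding caratheodory_dist_pseudo_dist using \<Phi>(1,2)
    by (intro SUP_upper[where f = "\<lambda>f. ereal (artanh (pseudo_dist (f (h 0)) (f (h (1 / 2)))))"]) (simp only: mem_Collect_eq)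
  then have "artanh (pseudo_dist 0 (1 / 2)) \<le> artanh (pseudo_dist (magic \<omega> (h 0)) (magic \<omega> (h (1 / 2))))"
    using d \<Phi>(3) by simp
  moreover have "cmod (magic \<omega> (h 0)) < 1" "cmod (magic \<omega> (h (1 / 2))) < 1"
    using magic_in_disc \<omega> in_G by auto
  moreover have "pseudo_dist 0 (1 / 2) < 1"
    by (rule pseudo_dist_less_1) auto
  ultimately have ge: "pseudo_dist 0 (1 / 2) \<le> pseudo_dist (magic \<omega> (h 0)) (magic \<omega> (h (1 / 2)))"
    by (simp add: artanh_le_iff pseudo_dist_nonneg pseudo_dist_less_1)
  have "(\<lambda>z. magic \<omega> (h z)) holomorphic_on unit_disc"
    using holomorphic_on_C2_compose[OF magic_holomorphic_on_C2[OF \<omega>] h] .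
  moreover have "(\<lambda>z. magic \<omega> (h z)) ` unit_disc \<subseteq> unit_disc"
    using h(3) magic_in_disc \<omega> by (auto simp: image_subset_iff)
  ultimately have "pseudo_dist (magic \<omega> (h 0)) (magic \<omega> (h (1 / 2))) \<le> pseudo_dist 0 (1 / 2)"
    by (rule Schwarz_Pick_le) auto
  with ge \<omega> show ?thesis
    using that by force
qed

text \<open>
  For $c = 1$ the function attached to $x$ is $-q(x)/(m-x)$ up to a real constant. When $q(x) > 0$ this is a
  Moebius map of the half-plane.
\<close>

lemma halfplane_magic_isometry:
  assumes m: "0 < Im m1" "0 < Im m2"
  shows "(cmod (halfplane_magic x m1 (real_quadratic a b 1 m1) - halfplane_magic x m2 (real_quadratic a b 1 m2)))\<^sup>2 * (Im m1 * Im m2)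
    = (cmod (m1 - m2))\<^sup>2 * (Im (halfplane_magic x m1 (real_quadratic a b 1 m1)) * Im (halfplane_magic x m2 (real_quadratic a b 1 m2)))"
  unfolding halfplane_magic_real_quadratic_diff[OF m] Im_halfplane_magic_real_quadratic[OF m(1)]
    Im_halfplane_magic_real_quadratic[OF m(2)] norm_mult power_mult_distrib
  by (simp add: norm_mult power_mult_distrib power2_eq_square del: of_real_add of_real_mult)

text \<open>
  One magic function $\Phi_\eta$ is an isometry on the geodesic, and rotating by $\eta$ turns it into $\Phi_1$. No
  other magic function expands distances on the geodesic, so $\Phi_1$ is extremal for all pairs of points, and
  the rotated geodesic is the graph of a real quadratic polynomial. Flatness excludes a leading coefficient
  other than $1$, and then every $\Phi_\omega$ preserves the distance of one pair of points. By the
  rigidity part of the Schwarz-Pick lemma it is an isometry onto the disc.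
\<close>

lemma flat_geodesic_magic_isometries:
  assumes "flat_geodesic F"
  obtains h where "F = h ` unit_disc" "inj_on h unit_disc" "h ` unit_disc \<subseteq> symm_bidisc"
    "\<And>\<omega> z w. cmod \<omega> = 1 \<Longrightarrow> z \<in> unit_disc \<Longrightarrow> w \<in> unit_disc \<Longrightarrow>
      pseudo_dist (magic \<omega> (h z)) (magic \<omega> (h w)) = pseudo_dist z w"
    "\<And>\<omega>. cmod \<omega> = 1 \<Longrightarrow> unit_disc \<subseteq> (\<lambda>z. magic \<omega> (h z)) ` unit_disc"
proof -
  obtain h \<Phi> where h: "(\<lambda>z. fst (h z)) holomorphic_on unit_disc" "(\<lambda>z. snd (h z)) holomorphic_on unit_disc"
      "h ` unit_disc \<subseteq> symm_bidisc"
    and \<Phi>: "holomorphic_on_C2 \<Phi> symm_bidisc" "\<Phi> ` symm_bidisc \<subseteq> unit_disc" "\<And>z. z \<in> unit_disc \<Longrightarrow> \<Phi> (h z) = z"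
    and F: "F = h ` unit_disc"
    using assms unfolding flat_geodesic_def complex_geodesic_def by blast
  have no_royal_boundary: "(2 * \<eta>, \<eta>\<^sup>2) \<notin> closure F" if "cmod \<eta> = 1" for \<eta>
  proof
    assume "(2 * \<eta>, \<eta>\<^sup>2) \<in> closure F"
    then have "(2 * \<eta>, \<eta>\<^sup>2) \<in> closure F \<inter> closure royal_variety"
      using royal_boundary_in_closure(1)[OF that] by blast
    moreover obtain p where "p \<in> royal_variety" "closure F \<inter> closure royal_variety = {p}"
      using assms unfolding flat_geodesic_def by blast
    ultimately have "(2 * \<eta>, \<eta>\<^sup>2) \<in> royal_variety"
      by simp
    then show False
      using royal_boundary_in_closure(2)[OF that] by blast
  qed
  have hol: "(\<lambda>z. magic \<omega> (h z)) holomorphic_on unit_disc" and disc: "(\<lambda>z. magic \<omega> (h z)) ` unit_disc \<subseteq> unit_disc"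
    if "cmod \<omega> = 1" for \<omega>
    using holomorphic_on_C2_compose[OF magic_holomorphic_on_C2[OF that] h] h(3) magic_in_disc that
    by (auto simp: image_subset_iff)
  have base: "(0::complex) \<in> unit_disc" "(1 / 2::complex) \<in> unit_disc" "0 \<noteq> (1 / 2 :: complex)"
    by auto
  obtain \<eta> where \<eta>: "cmod \<eta> = 1"
    and extremal: "pseudo_dist (magic \<eta> (h 0)) (magic \<eta> (h (1 / 2))) = pseudo_dist 0 (1 / 2)"
    using geodesic_extremal_magic[OF h \<Phi>] by blast
  note isometry = Schwarz_Pick_isometry[OF hol[OF \<eta>] disc[OF \<eta>] base extremal]
  note surj = Schwarz_Pick_surj[OF hol[OF \<eta>] disc[OF \<eta>] base extremal]
  define H where "H z = bidisc_rotation \<eta> (h z)" for z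
  have H_in: "H z \<in> symm_bidisc" if "z \<in> unit_disc" for z
    unfolding H_def by (rule bidisc_rotation_in_symm_bidisc[OF \<eta>]) (use h(3) that in blast)
  have "\<forall>z\<in>unit_disc. \<exists>m Q. 0 < Im m \<and> chart_denom m Q \<noteq> 0 \<and> H z = chart m Q"
    using symm_bidisc_chart H_in by metis
  then obtain m Q where mQ: "\<And>z. z \<in> unit_disc \<Longrightarrow> 0 < Im (m z)"
    "\<And>z. z \<in> unit_disc \<Longrightarrow> chart_denom (m z) (Q z) \<noteq> 0" "\<And>z. z \<in> unit_disc \<Longrightarrow> H z = chart (m z) (Q z)"
    by metis
  have in_G: "chart (m z) (Q z) \<in> symm_bidisc" if "z \<in> unit_disc" for z
    using H_in[OF that] mQ(3)[OF that] by simp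
  have H_dist: "pseudo_dist (magic \<omega> (H z)) (magic \<omega> (H w)) = pseudo_dist (magic (\<omega> * \<eta>) (h z)) (magic (\<omega> * \<eta>) (h w))" for \<omega> z w
    unfolding H_def by (rule pseudo_dist_magic_rotation[OF \<eta>])
  have max: "infinity_maximal (m z) (Q z) (m w) (Q w)" if z: "z \<in> unit_disc" and w: "w \<in> unit_disc" for z w
  proof (rule infinity_maximal_chart[OF mQ(1,2)[OF z] in_G[OF z] mQ(1,2)[OF w] in_G[OF w]])
    fix \<omega> :: complex assume "cmod \<omega> = 1"
    then have "cmod (\<omega> * \<eta>) = 1"
      using \<eta> by (simp add: norm_mult)
    then have "pseudo_dist (magic \<omega> (H z)) (magic \<omega> (H w)) \<le> pseudo_dist z w"
      unfolding H_dist by (intro Schwarz_Pick_le[OF hol disc] z w)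
    also have "\<dots> = pseudo_dist (magic 1 (H z)) (magic 1 (H w))"
      unfolding H_dist using isometry[OF z w] by simp
    finally show "pseudo_dist (magic \<omega> (chart (m z) (Q z))) (magic \<omega> (chart (m w) (Q w)))
        \<le> pseudo_dist (magic 1 (chart (m z) (Q z))) (magic 1 (chart (m w) (Q w)))"
      by (simp only: mQ(3)[OF z] mQ(3)[OF w])
  qed
  have m_surj: "\<exists>z\<in>unit_disc. m z = \<tau>" if \<tau>: "0 < Im \<tau>" for \<tau>
  proof -
    have "cmod (cayley \<tau>) < 1"
      using \<tau> cmod_cayley_less_1_iff plus_ii_nonzero by blast
    then have "- (cnj \<eta> * cayley \<tau>) \<in> unit_disc"
      using \<eta> by (simp add: norm_mult)
    then obtain z where z: "z \<in> unit_disc" "magic \<eta> (h z) = - (cnj \<eta> * cayley \<tau>)"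
      using surj by (metis imageE subsetD)
    have "\<eta> * cnj \<eta> = 1"
      using \<eta> by (metis complex_norm_square of_real_1 one_power2)
    then have "- cayley \<tau> = \<eta> * magic \<eta> (h z)"
      unfolding z(2) by (metis mult.assoc mult_1 mult_minus_right)
    also have "\<dots> = magic 1 (H z)"
      by (simp add: H_def magic_bidisc_rotation)
    also have "\<dots> = - cayley (m z)"
      using magic_1_chart mQ z by simp
    finally have "cayley (m z) = cayley \<tau>"
      by simp
    then have "m z = \<tau>"
      using mQ(1)[OF z(1)] \<tau> by (rule cayley_inject)
    then show ?thesis
      using z(1) by blast
  qed
  obtain a b c where Q: "\<And>z. z \<in> unit_disc \<Longrightarrow> Q z = real_quadratic a b c (m z)"
    using pairwise_infinity_maximal_real_quadratic[OF mQ(1) m_surj max] by blast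
  have "c = 1"
  proof (rule ccontr)
    assume "c \<noteq> 1"
    have "\<exists>z\<in>unit_disc. m z = of_nat (Suc n) * \<i>" for n
      by (rule m_surj) simp
    then obtain \<zeta> where \<zeta>: "\<And>n. \<zeta> n \<in> unit_disc" "\<And>n. m (\<zeta> n) = of_nat (Suc n) * \<i>"
      by metis
    \<comment> \<open>The rotated geodesic would reach the boundary point $(2,1)$ of the royal variety.\<close>
    have "(\<lambda>n. H (\<zeta> n)) \<longlonglongrightarrow> (2, 1)"
      using chart_real_quadratic_at_infinity[OF \<open>c \<noteq> 1\<close>, of a b] mQ(3)[OF \<zeta>(1)] Q[OF \<zeta>(1)] \<zeta>(2) by simp
    then have "(\<lambda>n. bidisc_rotation (cnj \<eta>) (H (\<zeta> n))) \<longlonglongrightarrow> bidisc_rotation (cnj \<eta>) (2, 1)"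
      unfolding bidisc_rotation_def by (intro tendsto_intros)
    then have "(\<lambda>n. h (\<zeta> n)) \<longlonglongrightarrow> (2 * cnj \<eta>, (cnj \<eta>)\<^sup>2)"
      by (simp add: H_def bidisc_rotation_inverse[OF \<eta>]) (simp add: bidisc_rotation_def mult.commute)
    moreover have "h (\<zeta> n) \<in> F" for n
      using F \<zeta>(1) by blast
    ultimately have "(2 * cnj \<eta>, (cnj \<eta>)\<^sup>2) \<in> closure F"
      unfolding closure_sequential by (intro exI[of _ "\<lambda>n. h (\<zeta> n)"]) simp
    then show False
      using no_royal_boundary[of "cnj \<eta>"] \<eta> by simp
  qed
  have all_extremal: "pseudo_dist (magic \<omega> (h 0)) (magic \<omega> (h (1 / 2))) = pseudo_dist 0 (1 / 2)" if \<omega>: "cmod \<omega> = 1" for \<omega>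
  proof (cases "\<omega> = \<eta>")
    case True
    then show ?thesis
      using extremal by simp
  next
    case False
    define \<omega>' where "\<omega>' = \<omega> * cnj \<eta>"
    have \<eta>1: "\<eta> * cnj \<eta> = 1"
      using \<eta> by (metis complex_norm_square of_real_1 one_power2)
    have \<omega>': "\<omega>' * \<eta> = \<omega>" "cmod \<omega>' = 1"
      using \<eta> \<eta>1 \<omega> by (auto simp: \<omega>'_def norm_mult mult.assoc mult.commute)
    have "\<omega>' \<noteq> 1"
      using \<omega>' False by auto
    then obtain x :: real where x: "\<omega>' = (of_real x + \<i>) / (of_real x - \<i>)"
      using unit_circle_real_parameter \<omega>'(2) by blast
    let ?z = "0 :: complex" and ?w = "1 / 2 :: complex"
    have pos: "0 < Im (halfplane_magic x (m z) (Q z))" if "z \<in> unit_disc" for z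
      using halfplane_magic_pos in_G mQ that by blast
    have eq: "(cmod (halfplane_magic x (m ?z) (Q ?z) - halfplane_magic x (m ?w) (Q ?w)))\<^sup>2 * (Im (m ?z) * Im (m ?w))
      = (cmod (m ?z - m ?w))\<^sup>2 * (Im (halfplane_magic x (m ?z) (Q ?z)) * Im (halfplane_magic x (m ?w) (Q ?w)))"
      unfolding Q[OF base(1)] Q[OF base(2)] \<open>c = 1\<close>
      by (rule halfplane_magic_isometry[OF mQ(1)[OF base(1)] mQ(1)[OF base(2)]])
    note le_iff = pseudo_dist_cayley_le_iff[OF pos[OF base(1)] pos[OF base(2)] mQ(1)[OF base(1)] mQ(1)[OF base(2)]]
      pseudo_dist_cayley_le_iff[OF mQ(1)[OF base(1)] mQ(1)[OF base(2)] pos[OF base(1)] pos[OF base(2)]]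
    have magic_H: "magic \<omega>' (H z) = - cayley (halfplane_magic x (m z) (Q z))" "magic 1 (H z) = - cayley (m z)"
      if "z \<in> unit_disc" for z
      using magic_chart(1)[OF mQ(2,1)[OF that] x] magic_1_chart[OF mQ(2,1)[OF that]] mQ(3)[OF that] by simp_all
    have "pseudo_dist (magic \<omega> (h ?z)) (magic \<omega> (h ?w)) = pseudo_dist (magic \<omega>' (H ?z)) (magic \<omega>' (H ?w))"
      unfolding H_dist \<omega>' ..
    also have "\<dots> = pseudo_dist (magic 1 (H ?z)) (magic 1 (H ?w))"
      unfolding magic_H[OF base(1)] magic_H[OF base(2)] by (rule antisym) (simp_all only: le_iff eq)
    also have "\<dots> = pseudo_dist ?z ?w"
      unfolding H_dist mult_1 by (rule extremal)
    finally show ?thesis .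
  qed
  show ?thesis
  proof (rule that[OF F _ h(3)])
    show "inj_on h unit_disc"
      using \<Phi>(3) by (metis inj_onI)
    show "pseudo_dist (magic \<omega> (h z)) (magic \<omega> (h w)) = pseudo_dist z w"
      if "cmod \<omega> = 1" "z \<in> unit_disc" "w \<in> unit_disc" for \<omega> z w
      using Schwarz_Pick_isometry[OF hol disc base all_extremal] that by blast
    show "unit_disc \<subseteq> (\<lambda>z. magic \<omega> (h z)) ` unit_disc" if "cmod \<omega> = 1" for \<omega>
      using Schwarz_Pick_surj[OF hol disc base all_extremal] that by blast
  qed
qed

theorem corollary1p5:
  fixes F :: "(complex \<times> complex) set" and \<mu> :: "complex \<times> complex"
  assumes "flat_geodesic F" and "\<mu> \<in> symm_bidisc"
  shows "\<exists>!l0. l0 \<in> F \<and>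
    caratheodory_dist symm_bidisc l0 \<mu> = (INF l\<in>F. caratheodory_dist symm_bidisc l \<mu>)"
proof -
  obtain h where F: "F = h ` unit_disc" and inj: "inj_on h unit_disc" and in_G: "h ` unit_disc \<subseteq> symm_bidisc"
    and isometry: "\<And>\<omega> z w. cmod \<omega> = 1 \<Longrightarrow> z \<in> unit_disc \<Longrightarrow> w \<in> unit_disc \<Longrightarrow>
      pseudo_dist (magic \<omega> (h z)) (magic \<omega> (h w)) = pseudo_dist z w"
    and surj: "\<And>\<omega>. cmod \<omega> = 1 \<Longrightarrow> unit_disc \<subseteq> (\<lambda>z. magic \<omega> (h z)) ` unit_disc"
    using flat_geodesic_magic_isometries[OF assms(1)] by metis
  have "\<exists>w\<in>unit_disc. magic \<omega> (h w) = magic \<omega> \<mu>" if \<omega>: "cmod \<omega> = 1" for \<omega>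
  proof -
    have "magic \<omega> \<mu> \<in> unit_disc"
      using magic_in_disc[OF assms(2) \<omega>] by simp
    then have "magic \<omega> \<mu> \<in> (\<lambda>z. magic \<omega> (h z)) ` unit_disc"
      by (rule subsetD[OF surj[OF \<omega>]])
    then obtain w where "w \<in> unit_disc" "magic \<omega> \<mu> = magic \<omega> (h w)"
      by (rule imageE)
    then show ?thesis
      by (intro bexI[of _ w]) simp_all
  qed
  \<comment> \<open>The point of the disc whose image on $F$ agrees with $\mu$ under $\Phi_\omega$.\<close>
  then obtain foot where foot: "\<And>\<omega>. cmod \<omega> = 1 \<Longrightarrow> foot \<omega> \<in> unit_disc"
    "\<And>\<omega>. cmod \<omega> = 1 \<Longrightarrow> magic \<omega> (h (foot \<omega>)) = magic \<omega> \<mu>"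
    by metis
  define K where "K = foot ` sphere 0 1"
  have foot_dist: "pseudo_dist (magic \<omega> (h z)) (magic \<omega> \<mu>) = pseudo_dist z (foot \<omega>)"
    if "cmod \<omega> = 1" "z \<in> unit_disc" for \<omega> z
    using isometry[OF that foot(1)[OF that(1)]] foot(2)[OF that(1)] by simp
  have "\<exists>r. (\<exists>w\<in>K. r = pseudo_dist z w) \<and> (\<forall>w\<in>K. pseudo_dist z w \<le> r) \<and>
      caratheodory_dist symm_bidisc (h z) \<mu> = ereal (artanh r)" if z: "z \<in> unit_disc" for z
  proof -
    have "h z \<in> symm_bidisc"
      using in_G z by blast
    then obtain \<omega> where \<omega>: "cmod \<omega> = 1"
      and max: "\<And>\<omega>'. cmod \<omega>' = 1 \<Longrightarrow> pseudo_dist (magic \<omega>' (h z)) (magic \<omega>' \<mu>)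
        \<le> pseudo_dist (magic \<omega> (h z)) (magic \<omega> \<mu>)"
      and d: "caratheodory_dist symm_bidisc (h z) \<mu> = ereal (artanh (pseudo_dist (magic \<omega> (h z)) (magic \<omega> \<mu>)))"
      using caratheodory_dist_symm_bidisc[OF _ assms(2)] by blast
    have "pseudo_dist z w \<le> pseudo_dist z (foot \<omega>)" if "w \<in> K" for w
      using that max foot_dist z \<omega> by (auto simp: K_def)
    moreover have "foot \<omega> \<in> K"
      using \<omega> by (simp add: K_def)
    ultimately show ?thesis
      using d foot_dist[OF \<omega> z] by auto
  qed
  then obtain r where r: "\<And>z. z \<in> unit_disc \<Longrightarrow> \<exists>w\<in>K. r z = pseudo_dist z w"
    "\<And>z w. z \<in> unit_disc \<Longrightarrow> w \<in> K \<Longrightarrow> pseudo_dist z w \<le> r z"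
    "\<And>z. z \<in> unit_disc \<Longrightarrow> caratheodory_dist symm_bidisc (h z) \<mu> = ereal (artanh (r z))"
    by metis
  have K: "K \<subseteq> unit_disc"
    unfolding K_def using foot(1) by (intro image_subsetI) simp
  have r01: "0 \<le> r z \<and> r z < 1" if z: "z \<in> unit_disc" for z
  proof -
    obtain w where "w \<in> K" "r z = pseudo_dist z w"
      using r(1)[OF z] by blast
    then show ?thesis
      using K z pseudo_dist_less_1[of w z] by (auto simp: pseudo_dist_nonneg)
  qed
  have is_min: "caratheodory_dist symm_bidisc (h z) \<mu> = (INF l\<in>F. caratheodory_dist symm_bidisc l \<mu>)
      \<longleftrightarrow> (\<forall>z'\<in>unit_disc. r z \<le> r z')" if z: "z \<in> unit_disc" for z
  proof -
    have "caratheodory_dist symm_bidisc (h z) \<mu> = (INF l\<in>F. caratheodory_dist symm_bidisc l \<mu>)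
        \<longleftrightarrow> caratheodory_dist symm_bidisc (h z) \<mu> \<le> (INF l\<in>F. caratheodory_dist symm_bidisc l \<mu>)"
      using z by (auto simp: F intro!: antisym INF_lower)
    also have "\<dots> \<longleftrightarrow> (\<forall>z'\<in>unit_disc. ereal (artanh (r z)) \<le> ereal (artanh (r z')))"
      using z by (simp add: F le_INF_iff r(3))
    also have "\<dots> \<longleftrightarrow> (\<forall>z'\<in>unit_disc. r z \<le> r z')"
      using r01 z by (simp add: artanh_le_iff)
    finally show ?thesis .
  qed
  obtain z where z: "z \<in> unit_disc" "\<forall>z'\<in>unit_disc. r z \<le> r z'"
    and uniq: "\<And>w. w \<in> unit_disc \<Longrightarrow> \<forall>z'\<in>unit_disc. r w \<le> r z' \<Longrightarrow> w = z"
    using Chebyshev_centre_unique[OF K r(1,2)] by blast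
  show ?thesis
  proof (rule ex1I[of _ "h z"])
    show "h z \<in> F \<and> caratheodory_dist symm_bidisc (h z) \<mu> = (INF l\<in>F. caratheodory_dist symm_bidisc l \<mu>)"
      using z is_min F by blast
    fix l assume l: "l \<in> F \<and> caratheodory_dist symm_bidisc l \<mu> = (INF l\<in>F. caratheodory_dist symm_bidisc l \<mu>)"
    then obtain w where "w \<in> unit_disc" "l = h w"
      using F by blast
    then show "l = h z"
      using uniq[of w] is_min[of w] l by blast
  qed
qed

end
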